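(* For $m=1,2,\ldots$ let $\alpha_m=w^{(m)}_{m,m}$ and $\beta_m=w^{(m)}_{m+1,m+1}$, and, when $\beta_m<R_0<\alpha_{m+1}$, let $\chi_m\in(m,m+1)$ be the solution of $w^{(\chi_m)}_{m+1,m+1}=R_0$. There exists an equilibrium threshold strategy with threshold value $$x_e=\begin{cases}0 & \text{if } R_0<\alpha_1,\\ \zeta_0 & \text{if } R_0=\alpha_1,\\ m & \text{if } \alpha_m\le R_0\le \beta_m,\quad m=1,2,\ldots,\\ \chi_m & \text{if } \beta_m<R_0<\alpha_{m+1},\quad m=1,2,\ldots,\end{cases}$$ where $\zeta_0\in[0,1]$ (any value in $[0,1]$ may be taken).
   Context: Model (no reneging). Parameters $\lambda,\mu>0$, $0<q<1$, $R_0>0$. Single-server first-come-first-served queue: Poisson arrivals of rate $\lambda$, i.i.d. exponential($\mu$) services. After each service a customer departs successfully with probability $q$, and otherwise (probability $1-q$) immediately rejoins the end of the queue. An arriving customer who sees $j-1$ customers in the system may join, taking position $j$ (position 1 is in service), or balk; once joined she stays until success. Waiting costs 1 per unit time, and success gives reward $R_0$; balking gives payoff $0$. Threshold strategy: for $x\ge 0$, with $n=\lfloor x\rfloor$ and $p=x-n$, a customer using threshold $x$ joins at position $i$ with probability $u^{(x)}(i)$, where $u^{(x)}(i)=1$ if $i\le n$, $u^{(x)}(n+1)=p$, and $u^{(x)}(i)=0$ if $i\ge n+2$. For $1\le i\le j\le\lceil x\rceil+1$, $w^{(x)}_{i,j}$ is the expected remaining time until a tagged customer departs when she is in position $i$,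 there are $j$ customers in the system and all other customers use threshold $x$. Equivalently, $(w^{(x)}_{i,j})$ is the unique solution of $$(\lambda+\mu)w_{i,j}=1+\lambda\left[u^{(x)}(j+1)w_{i,j+1}+(1-u^{(x)}(j+1))w_{i,j}\right]+\mu\, s_{i,j},$$ where $s_{1,j}=(1-q)w_{j,j}$ and $s_{i,j}=q\,w_{i-1,j-1}+(1-q)\,w_{i-1,j}$ for $i>1$ (terms with zero coefficient are omitted). Put $z^{(x)}_{i,j}=R_0-w^{(x)}_{i,j}$, the expected payoff. Equilibrium threshold strategy (symmetric Nash equilibrium): a threshold $x\geq 0$ is an equilibrium threshold if threshold $x$ is a best response for a tagged customer when all others use threshold $x$; that is, for every position $j\in\{1,\ldots,\lceil x\rceil+1\}$ at which she could join, $u^{(x)}(j)$ maximizes $a\,z^{(x)}_{j,j}$ over joining probabilities $a\in[0,1]$. *)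

theory Defs
  imports "HOL-Probability.Probability"
begin

text \<open>Parameters throughout: arrival rate \<open>lam\<close>, service rate \<open>mu\<close>, success probability \<open>q\<close>,
  reward \<open>R0\<close>, threshold \<open>x\<close>.\<close>

definition join_prob :: "real \<Rightarrow> nat \<Rightarrow> real" where
  "join_prob x i =
    (if i \<le> nat \<lfloor>x\<rfloor> then 1 else if i = nat \<lfloor>x\<rfloor> + 1 then frac x else 0)"

text \<open>
  A state \<open>Some (i, j)\<close> means that the tagged customer is in position \<open>i\<close> and that \<open>j\<close> customers
  are in the system; \<open>None\<close> means that the tagged customer has departed. The mark
  \<open>(a, s, v, b)\<close> of an epoch consists of the time \<open>a\<close> until the next arrival, the time \<open>s\<close> until
  the current service ends, a uniform variable \<open>v\<close> that decides whether the arriving customer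
  joins, and the success flag \<open>b\<close> of the service. Both clocks may be redrawn after every event,
  since they are exponential and hence memoryless.
\<close>

type_synonym state = "(nat \<times> nat) option"
type_synonym mark = "real \<times> real \<times> real \<times> bool"

fun next_state :: "real \<Rightarrow> mark \<Rightarrow> state \<Rightarrow> state" where
  "next_state x m None = None"
| "next_state x (a, s, v, b) (Some (i, j)) =
    (if a < s then
       (if v < join_prob x (j + 1) then Some (i, j + 1) else Some (i, j))
     else if i = 1 then
       (if b then None else Some (j, j))
     else
       (if b then Some (i - 1, j - 1) else Some (i - 1, j)))"

fun sojourn :: "mark \<Rightarrow> state \<Rightarrow> real" where
  "sojourn m None = 0"
| "sojourn (a, s, v, b) (Some _) = min a s"

primrec state_at :: "real \<Rightarrow> state \<Rightarrow> mark stream \<Rightarrow> nat \<Rightarrow> state" where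
  "state_at x st \<omega> 0 = st"
| "state_at x st \<omega> (Suc n) = next_state x (\<omega> !! n) (state_at x st \<omega> n)"

definition remaining_time :: "real \<Rightarrow> state \<Rightarrow> mark stream \<Rightarrow> ennreal" where
  "remaining_time x st \<omega> = (\<Sum>n. ennreal (sojourn (\<omega> !! n) (state_at x st \<omega> n)))"

definition mark_measure :: "real \<Rightarrow> real \<Rightarrow> real \<Rightarrow> mark measure" where
  "mark_measure lam mu q =
    density lborel (exponential_density lam) \<Otimes>\<^sub>M (density lborel (exponential_density mu) \<Otimes>\<^sub>M
      (uniform_measure lborel {0..1} \<Otimes>\<^sub>M measure_pmf (bernoulli_pmf q)))"

text \<open>
  For \<open>lam, mu > 0\<close>, \<open>0 < q < 1\<close> and \<open>x \<ge> 0\<close> the expectation is finite, so \<open>enn2real\<close> loses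
  nothing. Only \<open>1 \<le> i \<le> j \<le> \<lceil>x\<rceil> + 1\<close> is of interest.
\<close>

definition wait_time :: "real \<Rightarrow> real \<Rightarrow> real \<Rightarrow> real \<Rightarrow> nat \<Rightarrow> nat \<Rightarrow> real" where
  "wait_time lam mu q x i j =
    enn2real (\<integral>\<^sup>+ \<omega>. remaining_time x (Some (i, j)) \<omega> \<partial>stream_space (mark_measure lam mu q))"

definition payoff :: "real \<Rightarrow> real \<Rightarrow> real \<Rightarrow> real \<Rightarrow> real \<Rightarrow> nat \<Rightarrow> nat \<Rightarrow> real" where
  "payoff lam mu q R0 x i j = R0 - wait_time lam mu q x i j"

definition equilibrium_threshold :: "real \<Rightarrow> real \<Rightarrow> real \<Rightarrow> real \<Rightarrow> real \<Rightarrow> bool" where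
  "equilibrium_threshold lam mu q R0 x \<longleftrightarrow> 0 \<le> x \<and>
    (\<forall>j\<in>{1..nat \<lceil>x\<rceil> + 1}.
      is_arg_max (\<lambda>a. a * payoff lam mu q R0 x j j) (\<lambda>a. a \<in> {0..1}) (join_prob x j))"

definition alpha :: "real \<Rightarrow> real \<Rightarrow> real \<Rightarrow> nat \<Rightarrow> real" where
  "alpha lam mu q m = wait_time lam mu q (real m) m m"

definition beta :: "real \<Rightarrow> real \<Rightarrow> real \<Rightarrow> nat \<Rightarrow> real" where
  "beta lam mu q m = wait_time lam mu q (real m) (m + 1) (m + 1)"

definition is_chi :: "real \<Rightarrow> real \<Rightarrow> real \<Rightarrow> real \<Rightarrow> nat \<Rightarrow> real \<Rightarrow> bool" where
  "is_chi lam mu q R0 m c \<longleftrightarrow>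
    c \<in> {real m<..<real m + 1} \<and> wait_time lam mu q c (m + 1) (m + 1) = R0"

text \<open>
  The values \<open>x\<close> that the case distinction allows for the equilibrium threshold. It is a relation
  because every \<open>x \<in> [0,1]\<close> is allowed when \<open>R0 = \<alpha>\<^sub>1\<close>; in that situation the third case
  may apply as well, with \<open>m = 1\<close>.
\<close>

definition threshold_value :: "real \<Rightarrow> real \<Rightarrow> real \<Rightarrow> real \<Rightarrow> real \<Rightarrow> bool" where
  "threshold_value lam mu q R0 x \<longleftrightarrow>
    (R0 < alpha lam mu q 1 \<and> x = 0) \<or>
    (R0 = alpha lam mu q 1 \<and> x \<in> {0..1}) \<or>
    (\<exists>m\<ge>1. alpha lam mu q m \<le> R0 \<and> R0 \<le> beta lam mu q m \<and> x = real m) \<or>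
    (\<exists>m\<ge>1. beta lam mu q m < R0 \<and> R0 < alpha lam mu q (m + 1) \<and> is_chi lam mu q R0 m x)"

end

theory Submission
  imports Defs
begin

text \<open>
  Conditioning on the first event (arrival or end of service) turns the
  expected remaining time \<open>w i j\<close> of a tagged customer into a solution of the linear system of the
  model (\<open>wait_time_equation\<close>). Finiteness comes from an explicit supersolution that dominates the
  expected time spent in the first \<open>n\<close> epochs, for every \<open>n\<close> (\<open>truncated_wait_le\<close>). From then on the
  argument concerns only the linear system.

  On the triangle \<open>1 \<le> i \<le> j \<le> N\<close>, where nobody joins at position \<open>N + 1\<close>, the system obeys a
  comparison principle: supersolutions of the homogeneous system are nonnegative, because in every
  service cycle the tagged customer is sent back only with probability \<open>1 - q\<close>, which forces a
  negative minimum on the diagonal to contract to zero (\<open>comparison_principle\<close>).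

  The monotonicity of \<open>w\<close> is not evident from the system, since a customer in position 1 who fails
  is thrown to the end of the queue while one in position 2 moves to position 1. The remedy is to
  look at one cycle at a time, up to the end of the tagged customer's next service, with a prescribed
  cost \<open>f\<close> for being sent to the end of a queue of given length. If \<open>f\<close> is nondecreasing, then more
  customers behind the tagged one can only lead to a longer queue at the end of the cycle
  (\<open>cycle_mono\<close>), and one more customer in front amounts to waiting for one service and then starting
  a shorter cycle with at least as many customers behind (\<open>cycle_diagonal\<close>). Taking for \<open>f\<close> the
  largest nondecreasing minorant of \<open>j \<mapsto> w j j\<close> gives a cycle cost \<open>g \<le> w\<close> which, by this
  monotonicity, is itself a supersolution of the full system; hence \<open>g = w\<close> by comparison
  (\<open>wait_diagonal_mono\<close>). Therefore \<open>w j j\<close> grows by at least the mean service time \<open>1 / mu\<close> with each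
  \<open>j\<close>, and \<open>w i j\<close> is strictly increasing in \<open>j\<close>.

  Raising the threshold raises the joining probabilities. The difference of two solutions solves the
  system with a source proportional to \<open>w i (j + 1) - w i j > 0\<close>, so on \<open>[m, m + 1]\<close>, with \<open>m \<ge> 1\<close>,
  the function \<open>x \<mapsto> w\<^sup>(\<^sup>x\<^sup>) (m + 1) (m + 1)\<close> is strictly increasing and Lipschitz; it runs from
  \<open>\<beta>\<^sub>m\<close> to \<open>\<alpha>\<^sub>m\<^sub>+\<^sub>1\<close>. Hence \<open>\<chi>\<^sub>m\<close> exists and is unique, and
  \<open>\<alpha>\<^sub>1 < \<beta>\<^sub>1 < \<alpha>\<^sub>2 < \<beta>\<^sub>2 < \<dots>\<close> with \<open>\<alpha>\<^sub>m \<rightarrow> \<infinity>\<close>, so that the cases of the theorem are exhaustive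
  and, apart from \<open>R0 = \<alpha>\<^sub>1\<close>, exclusive. Finally, since \<open>w j j\<close> increases in \<open>j\<close>, the sign of the
  payoff is as required at all positions as soon as it is at positions \<open>m\<close> and \<open>m + 1\<close>
  (\<open>equilibrium_thresholdI\<close>).
\<close>

section \<open>Two competing exponential clocks\<close>

abbreviation exp_measure :: "real \<Rightarrow> real measure" where
  "exp_measure l \<equiv> density lborel (exponential_density l)"

lemma exponential_tail:
  assumes "0 < k" "0 \<le> a"
  shows "emeasure (exp_measure k) {a<..} = ennreal (exp (- k * a))"
    and "emeasure (exp_measure k) {a..} = ennreal (exp (- k * a))"
proof -
  interpret prob_space "exp_measure k"
    by (rule prob_space_exponential_density) fact
  have "distributed (exp_measure k) lborel (\<lambda>x. x) (exponential_density k)"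
    by (auto simp: distributed_def distr_id2 intro!: distr_id2)
  from exponential_distributedD_gt[OF this assms(2,1)]
  have "prob {x. a < x} = exp (- a * k)" by simp
  then show gt: "emeasure (exp_measure k) {a<..} = ennreal (exp (- k * a))"
    by (simp add: emeasure_eq_measure greaterThan_def mult.commute)
  have "emeasure (exp_measure k) {a..} = emeasure (exp_measure k) {a<..}"
  proof (rule emeasure_eq_AE)
    show "AE x in exp_measure k. (x \<in> {a..}) = (x \<in> {a<..})"
      using AE_lborel_singleton[of a] by (subst AE_density) (auto elim!: eventually_mono)
  qed auto
  with gt show "emeasure (exp_measure k) {a..} = ennreal (exp (- k * a))" by simp
qed

lemma AE_exponential_nonneg: "AE x in exp_measure l. 0 \<le> x"
  by (subst AE_density) (auto simp: exponential_density_def)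

text \<open>
  The clock \<open>a\<close> of rate \<open>l\<close> wins against \<open>s\<close> with probability \<open>exp (- k * a)\<close>, and tilting the density
  of rate \<open>l\<close> by this factor gives \<open>l / (l + k)\<close> times the density of rate \<open>l + k\<close>: given that \<open>a\<close>
  wins, its value is exponential with the total rate. The set \<open>A a\<close> may or may not contain \<open>a\<close>, so
  that the statement serves both for a win (\<open>a < s\<close>) and for its complement with the roles
  exchanged (\<open>s \<le> a\<close>).
\<close>
lemma exponential_race:
  assumes l: "0 < l" and k: "0 < k"
    and f [measurable]: "f \<in> borel_measurable borel"
    and A: "\<And>a. A a = {a<..} \<or> A a = {a..}"
  shows "(\<integral>\<^sup>+a. (\<integral>\<^sup>+s. f a * indicator (A a) s \<partial>exp_measure k) \<partial>exp_measure l) =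
    ennreal (l / (l + k)) * (\<integral>\<^sup>+a. f a \<partial>exp_measure (l + k))"
proof -
  have [measurable]: "A a \<in> sets borel" for a
    using A[of a] by (elim disjE) simp_all
  have tail: "emeasure (exp_measure k) (A a) = ennreal (exp (- k * a))" if "0 \<le> a" for a
    using A[of a] exponential_tail[OF k that] by (elim disjE) simp_all
  \<comment> \<open>The tilted density; for negative \<open>a\<close> both sides vanish.\<close>
  have dens: "exponential_density l a * exp (- k * a) =
      l / (l + k) * exponential_density (l + k) a" for a
    using l k by (simp add: exponential_density_def divide_simps algebra_simps flip: exp_add)
  have "(\<integral>\<^sup>+a. (\<integral>\<^sup>+s. f a * indicator (A a) s \<partial>exp_measure k) \<partial>exp_measure l) =
      (\<integral>\<^sup>+a. f a * emeasure (exp_measure k) (A a) \<partial>exp_measure l)"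
    by (intro nn_integral_cong) (simp add: nn_integral_cmult_indicator)
  also have "\<dots> = (\<integral>\<^sup>+a. f a * ennreal (exp (- k * a)) \<partial>exp_measure l)"
    using AE_exponential_nonneg[of l]
    by (intro nn_integral_cong_AE) (auto elim!: eventually_mono simp: tail)
  also have "\<dots> = (\<integral>\<^sup>+a. exponential_density l a * (f a * ennreal (exp (- k * a))) \<partial>lborel)"
    by (subst nn_integral_density) auto
  also have "\<dots> = (\<integral>\<^sup>+a. ennreal (l / (l + k)) * (exponential_density (l + k) a * f a) \<partial>lborel)"
  proof (intro nn_integral_cong)
    fix a
    have "ennreal (exponential_density l a) * ennreal (exp (- k * a)) =
        ennreal (l / (l + k)) * ennreal (exponential_density (l + k) a)"
      using l k dens[of a] by (simp add: exponential_density_nonneg flip: ennreal_mult)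
    then show "exponential_density l a * (f a * ennreal (exp (- k * a))) =
        ennreal (l / (l + k)) * (exponential_density (l + k) a * f a)"
      by (metis mult.assoc mult.commute)
  qed
  also have "\<dots> = ennreal (l / (l + k)) * (\<integral>\<^sup>+a. f a \<partial>exp_measure (l + k))"
    by (subst nn_integral_cmult) (auto simp: nn_integral_density)
  finally show ?thesis .
qed

lemma exponential_mean:
  assumes "0 < l"
  shows "(\<integral>\<^sup>+a. ennreal a \<partial>exp_measure l) = ennreal (1 / l)"
proof -
  interpret prob_space "exp_measure l"
    by (rule prob_space_exponential_density) fact
  have d: "distributed (exp_measure l) lborel (\<lambda>x. x) (exponential_density l)"
    by (auto simp: distributed_def distr_id2 intro!: distr_id2)
  have "expectation (\<lambda>x. x) = 1 / l"
    by (rule exponential_distributed_expectation[OF assms d])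
  moreover from this have "integrable (exp_measure l) (\<lambda>x. x)"
    using assms not_integrable_integral_eq by fastforce
  ultimately show ?thesis
    using AE_exponential_nonneg[of l] by (simp add: nn_integral_eq_integral)
qed

text \<open>
  Both terms of \<open>min a s + (if a < s then A else S)\<close> split according to the winning clock, and
  either way the minimum has mean \<open>1 / (l + k)\<close> independently of the winner.
\<close>
lemma exponential_clocks:
  fixes A S :: ennreal
  assumes l: "0 < l" and k: "0 < k"
  shows "(\<integral>\<^sup>+a. (\<integral>\<^sup>+s. ennreal (min a s) + (if a < s then A else S) \<partial>exp_measure k) \<partial>exp_measure l) =
    ennreal (1 / (l + k)) + (ennreal (l / (l + k)) * A + ennreal (k / (l + k)) * S)"
proof -
  interpret L: prob_space "exp_measure l" by (rule prob_space_exponential_density) fact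
  interpret K: prob_space "exp_measure k" by (rule prob_space_exponential_density) fact
  interpret LK: prob_space "exp_measure (l + k)"
    by (rule prob_space_exponential_density) (use l k in simp)
  interpret pair_sigma_finite "exp_measure k" "exp_measure l" ..
  have lk: "0 < l + k" "0 < k + l" using l k by auto
  have shifted: "(\<integral>\<^sup>+a. ennreal a + C \<partial>exp_measure (l + k)) = ennreal (1 / (l + k)) + C" for C
    by (subst nn_integral_add) (auto simp: exponential_mean[OF lk(1)] LK.emeasure_space_1[simplified])
  have "(\<integral>\<^sup>+a. (\<integral>\<^sup>+s. ennreal (min a s) + (if a < s then A else S) \<partial>exp_measure k) \<partial>exp_measure l) =
     (\<integral>\<^sup>+a. (\<integral>\<^sup>+s. (ennreal a + A) * indicator {a<..} s \<partial>exp_measure k)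
        + (\<integral>\<^sup>+s. (ennreal s + S) * indicator {s..} a \<partial>exp_measure k) \<partial>exp_measure l)"
    by (intro nn_integral_cong, subst nn_integral_add[symmetric])
       (auto intro!: nn_integral_cong simp: indicator_def min_def)
  also have "\<dots> = (\<integral>\<^sup>+a. (\<integral>\<^sup>+s. (ennreal a + A) * indicator {a<..} s \<partial>exp_measure k) \<partial>exp_measure l)
     + (\<integral>\<^sup>+a. (\<integral>\<^sup>+s. (ennreal s + S) * indicator {s..} a \<partial>exp_measure k) \<partial>exp_measure l)"
    by (rule nn_integral_add) (simp_all add: indicator_def)
  also have "(\<integral>\<^sup>+a. (\<integral>\<^sup>+s. (ennreal s + S) * indicator {s..} a \<partial>exp_measure k) \<partial>exp_measure l)
     = (\<integral>\<^sup>+s. (\<integral>\<^sup>+a. (ennreal s + S) * indicator {s..} a \<partial>exp_measure l) \<partial>exp_measure k)"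
    by (rule Fubini') (simp add: indicator_def)
  also have "\<dots> = ennreal (k / (k + l)) * (ennreal (1 / (l + k)) + S)"
    by (subst exponential_race[OF k l]) (auto simp: shifted add.commute[of k l])
  also have "(\<integral>\<^sup>+a. (\<integral>\<^sup>+s. (ennreal a + A) * indicator {a<..} s \<partial>exp_measure k) \<partial>exp_measure l)
     = ennreal (l / (l + k)) * (ennreal (1 / (l + k)) + A)"
    by (subst exponential_race[OF l k]) (auto simp: shifted)
  also have "ennreal (l / (l + k)) * (ennreal (1 / (l + k)) + A) +
      ennreal (k / (k + l)) * (ennreal (1 / (l + k)) + S) =
     (ennreal (l / (l + k)) + ennreal (k / (l + k))) * ennreal (1 / (l + k)) +
     (ennreal (l / (l + k)) * A + ennreal (k / (l + k)) * S)"
    by (simp add: distrib_left distrib_right add_ac)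
  also have "ennreal (l / (l + k)) + ennreal (k / (l + k)) = 1"
    using l k by (simp flip: ennreal_plus add_divide_distrib)
  finally show ?thesis by simp
qed

section \<open>First-step analysis of the remaining time\<close>

lemma prob_space_mark_measure:
  assumes "0 < lam" "0 < mu"
  shows "prob_space (mark_measure lam mu q)"
  unfolding mark_measure_def
  by (intro prob_space_pair prob_space_exponential_density assms prob_space_measure_pmf
      prob_space_uniform_measure) auto

lemma sets_mark_measure [measurable_cong]:
  "sets (mark_measure lam mu q) =
    sets (borel \<Otimes>\<^sub>M (borel \<Otimes>\<^sub>M (borel \<Otimes>\<^sub>M count_space UNIV)))"
  unfolding mark_measure_def by (intro sets_pair_measure_cong) auto

lemma measurable_next_state [measurable]:
  "(\<lambda>m. next_state x m st) \<in> measurable (mark_measure lam mu q) (count_space UNIV)"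
proof (cases st)
  case (Some p)
  obtain i j where p: "p = (i, j)" by (cases p)
  have "(\<lambda>m. next_state x m st) = (\<lambda>m.
      if fst m < fst (snd m) then
        (if fst (snd (snd m)) < join_prob x (j + 1) then Some (i, j + 1) else Some (i, j))
      else if i = 1 then (if snd (snd (snd m)) then None else Some (j, j))
      else (if snd (snd (snd m)) then Some (i - 1, j - 1) else Some (i - 1, j)))"
    by (auto simp: Some p fun_eq_iff)
  then show ?thesis by simp
qed simp

lemma measurable_sojourn [measurable]:
  "(\<lambda>m. sojourn m st) \<in> borel_measurable (mark_measure lam mu q)"
proof (cases st)
  case (Some p)
  then have "(\<lambda>m. sojourn m st) = (\<lambda>m. min (fst m) (fst (snd m)))"
    by (auto simp: fun_eq_iff)
  then show ?thesis by simp
next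
  case None
  then have "(\<lambda>m. sojourn m st) = (\<lambda>m. 0)" by (auto simp: fun_eq_iff)
  then show ?thesis by simp
qed

lemma measurable_state_at [measurable]:
  "(\<lambda>\<omega>. state_at x st \<omega> n) \<in>
    measurable (stream_space (mark_measure lam mu q)) (count_space UNIV)"
proof (induction n)
  case (Suc n)
  then show ?case
    using measurable_compose_countable[of "\<lambda>s \<omega>. next_state x (\<omega> !! n) s"
        "stream_space (mark_measure lam mu q)" "count_space UNIV" "\<lambda>\<omega>. state_at x st \<omega> n"]
    by simp
qed simp

lemma measurable_epoch_length [measurable]:
  "(\<lambda>\<omega>. sojourn (\<omega> !! n) (state_at x st \<omega> n)) \<in>
    borel_measurable (stream_space (mark_measure lam mu q))"
  using measurable_compose_countable[of "\<lambda>s \<omega>. sojourn (\<omega> !! n) s"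
      "stream_space (mark_measure lam mu q)" borel "\<lambda>\<omega>. state_at x st \<omega> n"]
  by simp

lemma state_at_SCons: "state_at x st (m ## \<omega>) (Suc n) = state_at x (next_state x m st) \<omega> n"
  by (induction n) auto

text \<open>
  The mean cost of one epoch followed by a continuation cost \<open>V\<close>. It is stated for arbitrary \<open>V\<close>
  because it is needed both for the expected remaining time itself and for the supersolution that
  bounds it.
\<close>
lemma one_step:
  fixes V :: "state \<Rightarrow> ennreal"
  assumes par: "0 < lam" "0 < mu" "0 < q" "q < 1" and u: "0 \<le> join_prob x (j + 1)" "join_prob x (j + 1) \<le> 1"
  shows "(\<integral>\<^sup>+m. ennreal (sojourn m (Some (i, j))) + V (next_state x m (Some (i, j)))
      \<partial>mark_measure lam mu q) =
    ennreal (1 / (lam + mu)) +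
    (ennreal (lam / (lam + mu)) *
      (ennreal (join_prob x (j + 1)) * V (Some (i, j + 1)) +
       ennreal (1 - join_prob x (j + 1)) * V (Some (i, j))) +
     ennreal (mu / (lam + mu)) *
      (if i = 1 then ennreal q * V None + ennreal (1 - q) * V (Some (j, j))
       else ennreal q * V (Some (i - 1, j - 1)) + ennreal (1 - q) * V (Some (i - 1, j))))"
    (is "?I = _ + (_ * ?A + _ * ?S)")
proof -
  let ?u = "join_prob x (j + 1)"
  let ?U = "uniform_measure lborel {0..1::real}" and ?B = "measure_pmf (bernoulli_pmf q)"
  let ?f = "\<lambda>m. ennreal (sojourn m (Some (i, j))) + V (next_state x m (Some (i, j)))"
  interpret L: prob_space "exp_measure lam" by (rule prob_space_exponential_density) fact
  interpret K: prob_space "exp_measure mu" by (rule prob_space_exponential_density) fact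
  interpret U: prob_space ?U by (rule prob_space_uniform_measure) auto
  interpret UB: pair_prob_space ?U ?B ..
  interpret KUB: pair_prob_space "exp_measure mu" "?U \<Otimes>\<^sub>M ?B" ..
  have V: "V \<in> borel_measurable (count_space UNIV)" by simp
  have meas: "?f \<in> borel_measurable (mark_measure lam mu q)"
    using measurable_compose[OF measurable_next_state V] by measurable
  note meas' = meas[unfolded mark_measure_def]
  have coin: "(\<integral>\<^sup>+v. (if v < ?u then X else Y) \<partial>?U) = ennreal ?u * X + ennreal (1 - ?u) * Y"
    for X Y :: ennreal
  proof -
    have "(\<integral>\<^sup>+v. (if v < ?u then X else Y) \<partial>?U) =
        (\<integral>\<^sup>+v. X * indicator {..<?u} v + Y * indicator {?u..} v \<partial>?U)"
      by (intro nn_integral_cong) (auto simp: indicator_def)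
    also have "\<dots> = X * emeasure ?U {..<?u} + Y * emeasure ?U {?u..}"
      by (subst nn_integral_add) (auto simp: nn_integral_cmult_indicator)
    also have "emeasure ?U {..<?u} = ennreal ?u"
    proof -
      have "{0..1} \<inter> {..<?u} = {0..<?u}" using u by auto
      then show ?thesis using u by (simp add: divide_ennreal_def)
    qed
    also have "emeasure ?U {?u..} = ennreal (1 - ?u)"
    proof -
      have "{0..1} \<inter> {?u..} = {?u..1}" using u by auto
      then show ?thesis using u by (simp add: divide_ennreal_def)
    qed
    finally show ?thesis by (simp add: mult.commute)
  qed
  have "?I = (\<integral>\<^sup>+a. (\<integral>\<^sup>+s. (\<integral>\<^sup>+v. (\<integral>\<^sup>+b. ?f (a, s, v, b) \<partial>?B) \<partial>?U) \<partial>exp_measure mu)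
      \<partial>exp_measure lam)"
    unfolding mark_measure_def
    apply (subst KUB.nn_integral_fst[symmetric, OF meas'])
    apply (intro nn_integral_cong)
    apply (subst UB.nn_integral_fst[symmetric])
    using meas' apply measurable
    apply (intro nn_integral_cong)
    apply (subst measure_pmf.nn_integral_fst[symmetric])
    using meas' apply measurable
    done
  also have "\<dots> = (\<integral>\<^sup>+a. (\<integral>\<^sup>+s. ennreal (min a s) + (if a < s then ?A else ?S) \<partial>exp_measure mu)
      \<partial>exp_measure lam)"
  proof (intro nn_integral_cong)
    fix a s :: real
    let ?rest = "if i = 1 then ennreal q * V None + ennreal (1 - q) * V (Some (j, j))
       else ennreal q * V (Some (i - 1, j - 1)) + ennreal (1 - q) * V (Some (i - 1, j))"
    have mix: "ennreal q * c + ennreal (1 - q) * c = c" for c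
      using par by (simp flip: distrib_right ennreal_plus)
    have b: "(\<integral>\<^sup>+b. ?f (a, s, v, b) \<partial>?B) = ennreal (min a s) +
        (if a < s then (if v < ?u then V (Some (i, j + 1)) else V (Some (i, j))) else ?rest)" for v
      using par by (subst nn_integral_add)
        (auto simp: measure_pmf.emeasure_space_1[simplified] mult.commute[of _ "ennreal _"] mix)
    show "(\<integral>\<^sup>+v. (\<integral>\<^sup>+b. ?f (a, s, v, b) \<partial>?B) \<partial>?U) = ennreal (min a s) + (if a < s then ?A else ?S)"
      unfolding b using U.emeasure_space_1
      by (subst nn_integral_add) (auto simp: coin[simplified])
  qed
  also have "\<dots> = ennreal (1 / (lam + mu)) + (ennreal (lam / (lam + mu)) * ?A + ennreal (mu / (lam + mu)) * ?S)"
    by (rule exponential_clocks) fact+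
  finally show ?thesis .
qed

lemma join_prob_bounds: "0 \<le> join_prob x i" "join_prob x i \<le> 1"
  by (auto simp: join_prob_def frac_lt_1 less_imp_le)

text \<open>
  The expected time that the tagged customer spends in the system during the first \<open>n\<close> epochs;
  induction on \<open>n\<close> is possible here, while the full remaining time is the supremum over \<open>n\<close>.
\<close>
definition truncated_wait :: "real \<Rightarrow> real \<Rightarrow> real \<Rightarrow> real \<Rightarrow> nat \<Rightarrow> state \<Rightarrow> ennreal" where
  "truncated_wait lam mu q x n st = (\<integral>\<^sup>+\<omega>. (\<Sum>k<n. ennreal (sojourn (\<omega> !! k) (state_at x st \<omega> k)))
     \<partial>stream_space (mark_measure lam mu q))"

text \<open>
  The expected remaining time before its conversion to a real number, so that the first-step
  equation can be derived before finiteness is known.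
\<close>
definition ennwait :: "real \<Rightarrow> real \<Rightarrow> real \<Rightarrow> real \<Rightarrow> state \<Rightarrow> ennreal" where
  "ennwait lam mu q x st =
     (\<integral>\<^sup>+\<omega>. remaining_time x st \<omega> \<partial>stream_space (mark_measure lam mu q))"

lemma state_at_None: "state_at x None \<omega> n = None"
  by (induction n) auto

lemma sojourn_None [simp]: "sojourn m None = 0"
  by (cases m) auto

lemma truncated_wait_None [simp]: "truncated_wait lam mu q x n None = 0"
  by (simp add: truncated_wait_def state_at_None)

lemma ennwait_None [simp]: "ennwait lam mu q x None = 0"
  by (simp add: ennwait_def remaining_time_def state_at_None)

lemma truncated_wait_0 [simp]: "truncated_wait lam mu q x 0 st = 0"
  by (simp add: truncated_wait_def)

lemma truncated_wait_Suc:
  assumes "0 < lam" "0 < mu"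
  shows "truncated_wait lam mu q x (Suc n) st =
    (\<integral>\<^sup>+m. ennreal (sojourn m st) + truncated_wait lam mu q x n (next_state x m st) \<partial>mark_measure lam mu q)"
proof -
  interpret prob_space "mark_measure lam mu q" by (rule prob_space_mark_measure) fact+
  interpret S: prob_space "stream_space (mark_measure lam mu q)" by (rule prob_space_stream_space)
  show ?thesis
    unfolding truncated_wait_def
    by (subst nn_integral_stream_space, measurable)
       (auto intro!: nn_integral_cong simp: sum.lessThan_Suc_shift state_at_SCons S.emeasure_space_1
         nn_integral_add simp del: state_at.simps(2) sum.lessThan_Suc)
qed

lemma ennwait_eq_SUP: "ennwait lam mu q x st = (SUP n. truncated_wait lam mu q x n st)"
proof -
  have "ennwait lam mu q x st = (\<Sum>k. \<integral>\<^sup>+\<omega>. ennreal (sojourn (\<omega> !! k) (state_at x st \<omega> k))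
     \<partial>stream_space (mark_measure lam mu q))"
    unfolding ennwait_def remaining_time_def by (rule nn_integral_suminf) measurable
  also have "\<dots> = (SUP n. truncated_wait lam mu q x n st)"
    unfolding suminf_eq_SUP truncated_wait_def by (subst nn_integral_sum) auto
  finally show ?thesis .
qed

lemma ennwait_step:
  assumes "0 < lam" "0 < mu"
  shows "ennwait lam mu q x st =
    (\<integral>\<^sup>+m. ennreal (sojourn m st) + ennwait lam mu q x (next_state x m st) \<partial>mark_measure lam mu q)"
proof -
  interpret prob_space "mark_measure lam mu q" by (rule prob_space_mark_measure) fact+
  interpret S: prob_space "stream_space (mark_measure lam mu q)" by (rule prob_space_stream_space)
  have [measurable]: "remaining_time x st \<in> borel_measurable (stream_space (mark_measure lam mu q))" for st
    unfolding remaining_time_def by measurable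
  have "remaining_time x st (m ## \<omega>) = ennreal (sojourn m st) + remaining_time x (next_state x m st) \<omega>"
    for m \<omega>
    unfolding remaining_time_def
    by (subst suminf_offset[where i = 1]) (auto simp: state_at_SCons add.commute simp del: state_at.simps(2))
  then show ?thesis
    unfolding ennwait_def
    by (subst nn_integral_stream_space, measurable)
       (auto intro!: nn_integral_cong simp: S.emeasure_space_1 nn_integral_add)
qed


section \<open>Finiteness and the linear system\<close>

lemma weighted_average_iff:
  fixes T :: real
  assumes "0 < T"
  shows "w = 1 / T + (l / T * a + k / T * b) \<longleftrightarrow> T * w = 1 + (l * a + k * b)"
proof -
  have eq: "1 / T + (l / T * a + k / T * b) = (1 + (l * a + k * b)) / T"
    by (simp add: add_divide_distrib)
  show ?thesis
    unfolding eq using assms by (simp add: eq_divide_eq mult.commute)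
qed

text \<open>
  Replacing the queue length by its largest possible value \<open>max j (\<lfloor>x\<rfloor> + 1)\<close>: the tagged customer
  waits for \<open>i\<close> services, and then on average for \<open>(1 - q) / q\<close> further cycles, each of them of at most
  that many services.
\<close>
definition wait_bound :: "real \<Rightarrow> real \<Rightarrow> real \<Rightarrow> nat \<Rightarrow> nat \<Rightarrow> real" where
  "wait_bound mu q x i j = (real i + (1 - q) / q * real (max j (nat \<lfloor>x\<rfloor> + 1))) / mu"

lemma wait_bound_supersolution:
  assumes "0 < mu" "0 < q" "q < 1" "1 \<le> i" "i \<le> j"
  shows "(if i = 1 then (1 - q) * wait_bound mu q x j j
     else q * wait_bound mu q x (i - 1) (j - 1) + (1 - q) * wait_bound mu q x (i - 1) j)
    \<le> wait_bound mu q x i j - 1 / mu" (is "?S \<le> _")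
proof -
  define M where "M j = real (max j (nat \<lfloor>x\<rfloor> + 1))" for j
  have M: "M (j - 1) \<le> M j" "real j \<le> M j"
    by (auto simp: M_def)
  have bound: "wait_bound mu q x i j = (real i + (1 - q) / q * M j) / mu" for i j
    by (simp add: wait_bound_def M_def)
  show ?thesis
  proof (cases "i = 1")
    case True
    have "mu * ?S = (1 - q) * (real j + (1 - q) / q * M j)"
      using True assms by (simp add: bound)
    also have "\<dots> \<le> (1 - q) * (M j + (1 - q) / q * M j)"
      using assms M by (intro mult_left_mono add_right_mono) auto
    also have "\<dots> = mu * (wait_bound mu q x i j - 1 / mu)"
      using assms True by (simp add: bound field_simps)
    finally show ?thesis using assms by simp
  next
    case False
    have "mu * ?S = real i - 1 + (1 - q) / q * (q * M (j - 1) + (1 - q) * M j)"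
      using False assms by (simp add: bound of_nat_diff field_simps)
    also have "\<dots> \<le> real i - 1 + (1 - q) / q * (q * M j + (1 - q) * M j)"
      using assms M by (intro add_left_mono mult_left_mono add_mono) auto
    also have "\<dots> = mu * (wait_bound mu q x i j - 1 / mu)"
      using assms by (simp add: bound field_simps)
    finally show ?thesis using assms by simp
  qed
qed

text \<open>
  The bound is not exceeded by the mean of one epoch plus the bound at the next state: an arrival that
  joins leaves \<open>max j (\<lfloor>x\<rfloor> + 1)\<close> unchanged, and the end of a service is covered by
  \<open>wait_bound_supersolution\<close>. Extending the bound by \<open>\<top>\<close> to states that do not occur makes the
  induction run over all states at once.
\<close>
lemma truncated_wait_le:
  assumes par: "0 < lam" "0 < mu" "0 < q" "q < 1" and ij: "1 \<le> i" "i \<le> j"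
  shows "truncated_wait lam mu q x n (Some (i, j)) \<le> ennreal (wait_bound mu q x i j)"
proof -
  define H where "H = (\<lambda>None \<Rightarrow> 0
    | Some (i, j) \<Rightarrow> if 1 \<le> i \<and> i \<le> j then ennreal (wait_bound mu q x i j) else \<top>)"
  have H: "H None = 0" "\<And>i j. 1 \<le> i \<Longrightarrow> i \<le> j \<Longrightarrow> H (Some (i, j)) = ennreal (wait_bound mu q x i j)"
    by (auto simp: H_def)
  have nn: "0 \<le> wait_bound mu q x i j" for i j
    using par by (simp add: wait_bound_def)
  have "truncated_wait lam mu q x n st \<le> H st" for st
  proof (induction n arbitrary: st)
    case (Suc n)
    show ?case
    proof (cases "\<exists>i j. st = Some (i, j) \<and> 1 \<le> i \<and> i \<le> j")
      case True
      then obtain i j where st: "st = Some (i, j)" and ij: "1 \<le> i" "i \<le> j" by blast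
      let ?u = "join_prob x (j + 1)" and ?h = "wait_bound mu q x i j"
      note u = join_prob_bounds[of x "j + 1"]
      have "truncated_wait lam mu q x (Suc n) st \<le>
          (\<integral>\<^sup>+m. ennreal (sojourn m (Some (i, j))) + H (next_state x m (Some (i, j))) \<partial>mark_measure lam mu q)"
        unfolding truncated_wait_Suc[OF par(1,2)] st
        by (intro nn_integral_mono add_left_mono Suc.IH)
      also have "\<dots> = ennreal (1 / (lam + mu)) +
        (ennreal (lam / (lam + mu)) *
          (ennreal ?u * H (Some (i, j + 1)) + ennreal (1 - ?u) * H (Some (i, j))) +
         ennreal (mu / (lam + mu)) *
          (if i = 1 then ennreal q * H None + ennreal (1 - q) * H (Some (j, j))
           else ennreal q * H (Some (i - 1, j - 1)) + ennreal (1 - q) * H (Some (i - 1, j))))"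
        by (rule one_step[OF par u])
      also have "ennreal ?u * H (Some (i, j + 1)) + ennreal (1 - ?u) * H (Some (i, j)) = ennreal ?h"
      proof (cases "j \<le> nat \<lfloor>x\<rfloor>")
        case True
        then have "wait_bound mu q x i (j + 1) = ?h" by (simp add: wait_bound_def max_def)
        then show ?thesis using ij u by (simp add: H flip: distrib_right ennreal_plus)
      next
        case False
        then have "?u = 0" by (simp add: join_prob_def)
        then show ?thesis using ij by (simp add: H)
      qed
      also have "(if i = 1 then ennreal q * H None + ennreal (1 - q) * H (Some (j, j))
           else ennreal q * H (Some (i - 1, j - 1)) + ennreal (1 - q) * H (Some (i - 1, j)))
         = ennreal (if i = 1 then (1 - q) * wait_bound mu q x j j
            else q * wait_bound mu q x (i - 1) (j - 1) + (1 - q) * wait_bound mu q x (i - 1) j)"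
        using ij par nn by (auto simp: H ennreal_mult ennreal_plus)
      also have "\<dots> \<le> ennreal (?h - 1 / mu)"
        using wait_bound_supersolution[OF par(2-4) ij] by (rule ennreal_leI)
      also have "ennreal (1 / (lam + mu)) + (ennreal (lam / (lam + mu)) * ennreal ?h +
          ennreal (mu / (lam + mu)) * ennreal (?h - 1 / mu)) = ennreal ?h"
      proof -
        have "1 / mu \<le> ?h"
          using par ij by (simp add: wait_bound_def divide_right_mono add_increasing2)
        moreover have "1 / (lam + mu) + (lam / (lam + mu) * ?h + mu / (lam + mu) * (?h - 1 / mu)) = ?h"
          by (rule weighted_average_iff[THEN iffD2, symmetric])
             (use par in \<open>simp_all add: algebra_simps\<close>)
        ultimately show ?thesis using par nn
          by (simp flip: ennreal_mult ennreal_plus)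
      qed
      also have "\<dots> = H st" using st ij by (simp add: H)
      finally show ?thesis by (simp add: add_left_mono mult_left_mono)
    next
      case False
      then show ?thesis by (cases st) (auto simp: H_def split: prod.splits)
    qed
  qed simp
  from this[of "Some (i, j)"] show ?thesis using ij by (simp add: H)
qed

lemma ennwait_le:
  assumes "0 < lam" "0 < mu" "0 < q" "q < 1" "1 \<le> i" "i \<le> j"
  shows "ennwait lam mu q x (Some (i, j)) \<le> ennreal (wait_bound mu q x i j)"
  unfolding ennwait_eq_SUP by (rule SUP_least) (rule truncated_wait_le[OF assms])

lemma ennwait_wait_time:
  assumes "0 < lam" "0 < mu" "0 < q" "q < 1" "1 \<le> i" "i \<le> j"
  shows "ennwait lam mu q x (Some (i, j)) = ennreal (wait_time lam mu q x i j)"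
  using ennwait_le[OF assms, of x] unfolding wait_time_def ennwait_def
  by (subst ennreal_enn2real) (auto simp: less_top[symmetric] top_unique)

lemma wait_time_nonneg: "0 \<le> wait_time lam mu q x i j"
  by (simp add: wait_time_def)

lemma wait_time_le:
  assumes "0 < lam" "0 < mu" "0 < q" "q < 1" "1 \<le> i" "i \<le> j"
  shows "wait_time lam mu q x i j \<le> wait_bound mu q x i j"
  using ennwait_le[OF assms, of x] unfolding ennwait_wait_time[OF assms]
  by (subst (asm) ennreal_le_iff) (use assms in \<open>auto simp: wait_bound_def\<close>)

text \<open>
  The system of the model, with the arrivals that balk cancelled from both sides.
\<close>
lemma wait_time_equation:
  fixes lam mu q x :: real
  assumes par: "0 < lam" "0 < mu" "0 < q" "q < 1" and ij: "1 \<le> i" "i \<le> j"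
  defines "u \<equiv> join_prob x (j + 1)" and "w \<equiv> wait_time lam mu q x"
  shows "(lam * u + mu) * w i j = 1 + lam * u * w i (j + 1) +
     mu * (if i = 1 then (1 - q) * w j j else q * w (i - 1) (j - 1) + (1 - q) * w (i - 1) j)"
    (is "_ = 1 + _ + mu * ?S")
proof -
  have u: "0 \<le> u" "u \<le> 1" by (auto simp: u_def join_prob_bounds)
  have V: "ennwait lam mu q x (Some (i, j)) = ennreal (w i j)" if "1 \<le> i" "i \<le> j" for i j
    unfolding w_def by (rule ennwait_wait_time) fact+
  have w: "0 \<le> w i j" for i j by (simp add: w_def wait_time_nonneg)
  have S: "0 \<le> ?S" using par w by simp
  have "ennreal (w i j) = ennwait lam mu q x (Some (i, j))" using ij by (simp add: V)
  also have "\<dots> = ennreal (1 / (lam + mu)) + (ennreal (lam / (lam + mu)) *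
      (ennreal u * ennreal (w i (j + 1)) + ennreal (1 - u) * ennreal (w i j)) +
      ennreal (mu / (lam + mu)) * ennreal ?S)"
  proof -
    have "(if i = 1 then ennreal q * ennwait lam mu q x None + ennreal (1 - q) * ennwait lam mu q x (Some (j, j))
        else ennreal q * ennwait lam mu q x (Some (i - 1, j - 1)) +
          ennreal (1 - q) * ennwait lam mu q x (Some (i - 1, j))) = ennreal ?S"
      using ij par w by (auto simp: V ennreal_mult ennreal_plus)
    then show ?thesis
      using ij by (subst ennwait_step[OF par(1,2)], subst one_step[OF par join_prob_bounds])
        (simp add: V u_def)
  qed
  also have "\<dots> = ennreal (1 / (lam + mu) + (lam / (lam + mu) * (u * w i (j + 1) + (1 - u) * w i j) +
      mu / (lam + mu) * ?S))"
  proof -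
    have "ennreal c + (ennreal p * (ennreal u * ennreal a + ennreal (1 - u) * ennreal b) + ennreal r * ennreal s)
      = ennreal (c + (p * (u * a + (1 - u) * b) + r * s))"
      if "0 \<le> c" "0 \<le> p" "0 \<le> r" "0 \<le> a" "0 \<le> b" "0 \<le> s" for c p r a b s
      using that u by (simp flip: ennreal_mult ennreal_plus)
    then show ?thesis using par w S by simp
  qed
  finally have "w i j = 1 / (lam + mu) + (lam / (lam + mu) * (u * w i (j + 1) + (1 - u) * w i j) +
      mu / (lam + mu) * ?S)"
    by (rule ennreal_inj[THEN iffD1, rotated 2]) (use par u w S in auto)
  then have "(lam + mu) * w i j = 1 + (lam * (u * w i (j + 1) + (1 - u) * w i j) + mu * ?S)"
    by (rule weighted_average_iff[THEN iffD1, rotated]) (use par in simp)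
  then show ?thesis by (simp add: algebra_simps)
qed

section \<open>The linear system and its comparison principle\<close>

text \<open>
  The expected cost after a service, where \<open>f j\<close> is the cost of having failed and being last in a queue
  of length \<open>j\<close>. The choice \<open>f j = w j j\<close> gives the system of the model; a general \<open>f\<close> describes a
  single cycle up to the end of the tagged customer's next service.
\<close>
definition after_service :: "real \<Rightarrow> (nat \<Rightarrow> real) \<Rightarrow> (nat \<Rightarrow> nat \<Rightarrow> real) \<Rightarrow> nat \<Rightarrow> nat \<Rightarrow> real" where
  "after_service q f w i j =
     (if i = 1 then (1 - q) * f j else q * w (i - 1) (j - 1) + (1 - q) * w (i - 1) j)"

definition joining_up_to :: "nat \<Rightarrow> (nat \<Rightarrow> real) \<Rightarrow> bool" where
  "joining_up_to N u \<longleftrightarrow> (\<forall>j. 0 \<le> u j) \<and> u (N + 1) = 0"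

lemma joining_nonneg: "joining_up_to N u \<Longrightarrow> 0 \<le> u j"
  and joining_zero: "joining_up_to N u \<Longrightarrow> u (N + 1) = 0"
  by (auto simp: joining_up_to_def)

locale feedback_queue =
  fixes lam mu q :: real
  assumes lam_pos: "0 < lam" and mu_pos: "0 < mu" and q_pos: "0 < q" and q_less_1: "q < 1"
begin

definition solves_cycle :: "(nat \<Rightarrow> real) \<Rightarrow> nat \<Rightarrow> (nat \<Rightarrow> real) \<Rightarrow> (nat \<Rightarrow> nat \<Rightarrow> real) \<Rightarrow> bool" where
  "solves_cycle u N f w \<longleftrightarrow> (\<forall>i j. 1 \<le> i \<longrightarrow> i \<le> j \<longrightarrow> j \<le> N \<longrightarrow>
     (lam * u (j + 1) + mu) * w i j =
     1 + lam * u (j + 1) * w i (j + 1) + mu * after_service q f w i j)"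

abbreviation solves_wait :: "(nat \<Rightarrow> real) \<Rightarrow> nat \<Rightarrow> (nat \<Rightarrow> nat \<Rightarrow> real) \<Rightarrow> bool" where
  "solves_wait u N w \<equiv> solves_cycle u N (\<lambda>j. w j j) w"

lemma solves_cycleD:
  assumes "solves_cycle u N f w" "1 \<le> i" "i \<le> j" "j \<le> N"
  shows "(lam * u (j + 1) + mu) * w i j =
     1 + lam * u (j + 1) * w i (j + 1) + mu * after_service q f w i j"
  using assms by (auto simp: solves_cycle_def)

lemma event_rate_pos:
  assumes "0 \<le> u"
  shows "0 < lam * u + mu"
  using assms lam_pos mu_pos by (simp add: add_nonneg_pos)

text \<open>
  For fixed \<open>i\<close> the equations couple \<open>d j\<close> only to \<open>d (j + 1)\<close>, and not at all at \<open>j = N\<close>, so they can be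
  treated by downward induction on \<open>j\<close>.
\<close>
lemma row_lower_bound:
  fixes d :: "nat \<Rightarrow> real"
  assumes u: "joining_up_to N u"
    and super: "\<And>j. i \<le> j \<Longrightarrow> j \<le> N \<Longrightarrow>
      lam * u (j + 1) * d (j + 1) + mu * c \<le> (lam * u (j + 1) + mu) * d j"
    and j: "i \<le> j" "j \<le> N"
  shows "c \<le> d j"
  using j(2,1)
proof (induction rule: inc_induct)
  case base
  then show ?case using super[of N] joining_zero[OF u] mu_pos by simp
next
  case (step j)
  have "c \<le> d (j + 1)" using step by simp
  then have "lam * u (j + 1) * c \<le> lam * u (j + 1) * d (j + 1)"
    using joining_nonneg[OF u, of "j + 1"] lam_pos by (intro mult_left_mono) auto
  then have "(lam * u (j + 1) + mu) * c \<le> (lam * u (j + 1) + mu) * d j"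
    using super[of j] step by (simp add: distrib_right)
  then show ?case
    using event_rate_pos[OF joining_nonneg[OF u, of "j + 1"]] by simp
qed

text \<open>
  Subtracting consecutive equations shows that the increment of \<open>d\<close> at \<open>j\<close> is driven by the increment of \<open>s\<close> at \<open>j\<close> and by that of \<open>d\<close> at \<open>j + 1\<close>, both with nonnegative
  weights.
\<close>
lemma row_increment:
  fixes d s :: "nat \<Rightarrow> real"
  assumes u: "joining_up_to N u"
    and row: "\<And>j. i \<le> j \<Longrightarrow> j \<le> N \<Longrightarrow>
      (lam * u (j + 1) + mu) * d j = 1 + lam * u (j + 1) * d (j + 1) + mu * s j"
    and s: "\<And>j. i \<le> j \<Longrightarrow> j < N \<Longrightarrow> s j \<le> s (j + 1)"
    and j: "i \<le> j" "j < N"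
  shows "mu * (s (j + 1) - s j) \<le> (lam * u (j + 1) + mu) * (d (j + 1) - d j)" "d j \<le> d (j + 1)"
proof -
  have diff: "(lam * u (j + 1) + mu) * (d (j + 1) - d j) =
      lam * u (j + 2) * (d (j + 2) - d (j + 1)) + mu * (s (j + 1) - s j)"
    if "i \<le> j" "j < N" for j
    using row[of j] row[of "j + 1"] that by (simp add: algebra_simps)
  have lower: "mu * (s (j + 1) - s j) \<le> (lam * u (j + 1) + mu) * (d (j + 1) - d j) \<and> d j \<le> d (j + 1)"
    if j: "i \<le> j" "j < N" and next_le: "Suc j < N \<Longrightarrow> d (Suc j) \<le> d (Suc (Suc j))" for j
  proof -
    have "0 \<le> u (j + 2) * (d (j + 2) - d (j + 1))"
    proof (cases "Suc j < N")
      case True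
      then show ?thesis using next_le joining_nonneg[OF u] by simp
    next
      case False
      then have "j + 2 = N + 1" using j by simp
      then have "u (j + 2) = 0" using joining_zero[OF u] by simp
      then show ?thesis by simp
    qed
    then have "0 \<le> lam * u (j + 2) * (d (j + 2) - d (j + 1))"
      using lam_pos by (simp add: mult.assoc)
    with diff[OF j]
    have 1: "mu * (s (j + 1) - s j) \<le> (lam * u (j + 1) + mu) * (d (j + 1) - d j)" by simp
    have "0 \<le> mu * (s (j + 1) - s j)" using s[OF j] mu_pos by simp
    with 1 have "0 \<le> (lam * u (j + 1) + mu) * (d (j + 1) - d j)" by linarith
    then have "0 \<le> d (j + 1) - d j"
      using event_rate_pos[OF joining_nonneg[OF u, of "j + 1"]] by (simp add: zero_le_mult_iff)
    with 1 show ?thesis by simp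
  qed
  have le: "j < N \<longrightarrow> d j \<le> d (j + 1)" if "i \<le> j" "j \<le> N" for j
    using that(2,1)
  proof (induction rule: inc_induct)
    case (step n)
    then show ?case using lower[of n] by auto
  qed simp
  show "mu * (s (j + 1) - s j) \<le> (lam * u (j + 1) + mu) * (d (j + 1) - d j)" "d j \<le> d (j + 1)"
    using lower[OF j] le[of "Suc j"] j by auto
qed

text \<open>
  In position 1 the bound comes from \<open>f\<close>; in the other positions \<open>after_service\<close> is an average over
  position \<open>i - 1\<close>, so the bound passes from one position to the next.
\<close>
lemma cycle_lower_bound:
  fixes D :: "nat \<Rightarrow> nat \<Rightarrow> real"
  assumes u: "joining_up_to N u"
    and super: "\<And>i j. 1 \<le> i \<Longrightarrow> i \<le> j \<Longrightarrow> j \<le> N \<Longrightarrow>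
      lam * u (j + 1) * D i (j + 1) + mu * after_service q f D i j \<le> (lam * u (j + 1) + mu) * D i j"
    and f: "\<And>j. 1 \<le> j \<Longrightarrow> j \<le> N \<Longrightarrow> c \<le> (1 - q) * f j"
    and ij: "1 \<le> i" "i \<le> j" "j \<le> N"
  shows "c \<le> D i j"
  using ij
proof (induction i arbitrary: j rule: nat_induct_at_least[of 1])
  case base
  show ?case
  proof (rule row_lower_bound[OF u _ base])
    fix j assume j: "1 \<le> j" "j \<le> N"
    then have "mu * c \<le> mu * after_service q f D 1 j"
      using mu_pos f by (simp add: after_service_def)
    with super[of 1 j] j
    show "lam * u (j + 1) * D 1 (j + 1) + mu * c \<le> (lam * u (j + 1) + mu) * D 1 j"
      by linarith
  qed
next
  case (Suc i)
  show ?case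
  proof (rule row_lower_bound[OF u _ Suc.prems])
    fix j assume j: "Suc i \<le> j" "j \<le> N"
    have "q * c + (1 - q) * c \<le> q * D i (j - 1) + (1 - q) * D i j"
      using Suc.IH[of "j - 1"] Suc.IH[of j] j q_pos q_less_1 Suc.hyps
      by (intro add_mono mult_left_mono) auto
    moreover have "q * c + (1 - q) * c = c"
      by (simp add: algebra_simps)
    ultimately have "c \<le> after_service q f D (Suc i) j"
      using Suc.hyps by (simp add: after_service_def)
    then have "mu * c \<le> mu * after_service q f D (Suc i) j"
      using mu_pos by simp
    with super[of "Suc i" j] j
    show "lam * u (j + 1) * D (Suc i) (j + 1) + mu * c \<le> (lam * u (j + 1) + mu) * D (Suc i) j"
      by simp
  qed
qed

text \<open>
  Let \<open>M \<le> 0\<close> be a lower bound of the diagonal that is attained or zero. One cycle improves the bound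
  \<open>M\<close> to \<open>(1 - q) * M\<close> everywhere, in particular where \<open>M\<close> is attained, hence \<open>M = 0\<close>.
\<close>
lemma comparison_principle:
  fixes D :: "nat \<Rightarrow> nat \<Rightarrow> real"
  assumes u: "joining_up_to N u"
    and super: "\<And>i j. 1 \<le> i \<Longrightarrow> i \<le> j \<Longrightarrow> j \<le> N \<Longrightarrow>
      lam * u (j + 1) * D i (j + 1) + mu * after_service q (\<lambda>j. D j j) D i j
        \<le> (lam * u (j + 1) + mu) * D i j"
    and ij: "1 \<le> i" "i \<le> j" "j \<le> N"
  shows "0 \<le> D i j"
proof -
  \<comment> \<open>Inserting \<open>0\<close> makes the minimum nonpositive and keeps the set nonempty for \<open>N = 0\<close>.\<close>
  define X where "X = insert 0 ((\<lambda>j. D j j) ` {1..N})"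
  define M where "M = Min X"
  have X: "finite X" "X \<noteq> {}" by (auto simp: X_def)
  have M_le: "M \<le> D j j" if "1 \<le> j" "j \<le> N" for j
    unfolding M_def using X that by (intro Min_le) (auto simp: X_def)
  have M: "(1 - q) * M \<le> D i j" if "1 \<le> i" "i \<le> j" "j \<le> N" for i j
  proof (rule cycle_lower_bound[OF u super _ that])
    fix j assume "1 \<le> j" "j \<le> N"
    then show "(1 - q) * M \<le> (1 - q) * D j j"
      using M_le q_less_1 by (simp add: mult_left_mono)
  qed
  have "M \<in> X" unfolding M_def using X by (rule Min_in)
  then have "0 \<le> M"
  proof (unfold X_def, elim insertE imageE)
    fix j assume "M = D j j" "j \<in> {1..N}"
    then have "(1 - q) * M \<le> M" using M[of j j] by simp
    then have "0 \<le> q * M" by (simp add: left_diff_distrib)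
    then show "0 \<le> M" using q_pos by (simp add: zero_le_mult_iff)
  qed simp
  then have "0 \<le> (1 - q) * M" using q_less_1 by simp
  with M[OF ij] show ?thesis by linarith
qed

section \<open>Monotonicity within one cycle\<close>

text \<open>
  Additional customers behind the tagged one do not delay the end of the cycle, they only lengthen the
  queue at that time.
\<close>
lemma cycle_mono:
  assumes u: "joining_up_to N u"
    and g: "solves_cycle u N f g"
    and f: "\<And>j. 1 \<le> j \<Longrightarrow> j < N \<Longrightarrow> f j \<le> f (j + 1)"
    and ij: "1 \<le> i" "i \<le> j" "j < N"
  shows "g i j \<le> g i (j + 1)"
  using ij
proof (induction i arbitrary: j rule: nat_induct_at_least[of 1])
  case base
  show ?case
  proof (rule row_increment(2)[OF u _ _ base])
    show "(lam * u (j + 1) + mu) * g 1 j =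
      1 + lam * u (j + 1) * g 1 (j + 1) + mu * after_service q f g 1 j" if "1 \<le> j" "j \<le> N" for j
      using that by (intro solves_cycleD[OF g]) auto
    show "after_service q f g 1 j \<le> after_service q f g 1 (j + 1)" if "1 \<le> j" "j < N" for j
      using f[OF that] q_less_1 by (simp add: after_service_def)
  qed
next
  case (Suc i)
  show ?case
  proof (rule row_increment(2)[OF u _ _ Suc.prems])
    show "(lam * u (j + 1) + mu) * g (Suc i) j =
      1 + lam * u (j + 1) * g (Suc i) (j + 1) + mu * after_service q f g (Suc i) j"
      if "Suc i \<le> j" "j \<le> N" for j
      using that by (intro solves_cycleD[OF g]) auto
    show "after_service q f g (Suc i) j \<le> after_service q f g (Suc i) (j + 1)"
      if "Suc i \<le> j" "j < N" for j
    proof -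
      have "q * g i (j - 1) + (1 - q) * g i j \<le> q * g i j + (1 - q) * g i (j + 1)"
        using Suc.IH[of "j - 1"] Suc.IH[of j] that q_pos q_less_1
        by (intro add_mono mult_left_mono) auto
      then show ?thesis using Suc.hyps by (simp add: after_service_def)
    qed
  qed
qed

lemma cycle_mono':
  assumes u: "joining_up_to N u"
    and g: "solves_cycle u N f g"
    and f: "\<And>j. 1 \<le> j \<Longrightarrow> j < N \<Longrightarrow> f j \<le> f (j + 1)"
    and ij: "1 \<le> i" "i \<le> j" "j \<le> k" "k \<le> N"
  shows "g i j \<le> g i k"
  using ij(3,4)
proof (induction rule: dec_induct)
  case (step n)
  then have "g i n \<le> g i (n + 1)" using ij by (intro cycle_mono[OF u g f]) auto
  with step show ?case by simp
qed simp

text \<open>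
  Starting one position further back, one service of mean length \<open>1 / mu\<close> passes before the tagged
  customer is in position \<open>i\<close>, and then there are at least \<open>i\<close> customers in the system, whether or not the
  customer who was served has left; \<open>cycle_mono\<close> compares this with \<open>g i i\<close>.
\<close>
lemma cycle_diagonal:
  assumes u: "joining_up_to N u"
    and g: "solves_cycle u N f g"
    and f: "\<And>j. 1 \<le> j \<Longrightarrow> j < N \<Longrightarrow> f j \<le> f (j + 1)"
    and ij: "1 \<le> i" "i < j" "j \<le> N"
  shows "g i i + 1 / mu \<le> g (i + 1) j"
proof (rule row_lower_bound[OF u])
  fix j assume j: "i + 1 \<le> j" "j \<le> N"
  have "q * g i i + (1 - q) * g i i \<le> q * g i (j - 1) + (1 - q) * g i j"
    using j ij q_pos q_less_1 cycle_mono'[OF u g f, of i i]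
    by (intro add_mono mult_left_mono) auto
  then have "g i i \<le> after_service q f g (i + 1) j"
    using ij by (simp add: after_service_def algebra_simps)
  then have "mu * (g i i + 1 / mu) \<le> 1 + mu * after_service q f g (i + 1) j"
    using mu_pos by (simp add: distrib_left)
  then show "lam * u (j + 1) * g (i + 1) (j + 1) + mu * (g i i + 1 / mu) \<le>
      (lam * u (j + 1) + mu) * g (i + 1) j"
    using solves_cycleD[OF g, of "i + 1" j] ij j by simp
qed (use ij in auto)

text \<open>
  The solution of the one-cycle system, computed from larger to smaller \<open>j\<close> and from smaller to larger
  \<open>i\<close>.
\<close>
function cycle_wait :: "(nat \<Rightarrow> real) \<Rightarrow> nat \<Rightarrow> (nat \<Rightarrow> real) \<Rightarrow> nat \<Rightarrow> nat \<Rightarrow> real" where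
  "cycle_wait u N f i j =
     (if j < N then
        (1 + lam * u (j + 1) * cycle_wait u N f i (j + 1) +
          mu * (if i \<le> 1 then (1 - q) * f j
            else q * cycle_wait u N f (i - 1) (j - 1) + (1 - q) * cycle_wait u N f (i - 1) j))
        / (lam * u (j + 1) + mu)
      else 1 / mu + (if i \<le> 1 then (1 - q) * f j
        else q * cycle_wait u N f (i - 1) (j - 1) + (1 - q) * cycle_wait u N f (i - 1) j))"
  by pat_completeness auto
termination
  by (relation "measures [\<lambda>(u, N, f, i, j). i, \<lambda>(u, N, f, i, j). N - j]") auto

declare cycle_wait.simps [simp del]

lemma solves_cycle_cycle_wait:
  assumes u: "joining_up_to N u"
  shows "solves_cycle u N f (cycle_wait u N f)"
  unfolding solves_cycle_def
proof (intro allI impI)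
  fix i j :: nat
  assume ij: "1 \<le> i" "i \<le> j" "j \<le> N"
  then have i: "i \<le> Suc 0 \<longleftrightarrow> i = Suc 0" by auto
  show "(lam * u (j + 1) + mu) * cycle_wait u N f i j =
     1 + lam * u (j + 1) * cycle_wait u N f i (j + 1) + mu * after_service q f (cycle_wait u N f) i j"
  proof (cases "j < N")
    case True
    then show ?thesis
      using event_rate_pos[OF joining_nonneg[OF u, of "j + 1"]] unfolding after_service_def
      by (subst cycle_wait.simps) (simp add: i)
  next
    case False
    then have "j = N" using ij by simp
    then show ?thesis
      using joining_zero[OF u] mu_pos unfolding after_service_def
      by (subst cycle_wait.simps) (simp add: i distrib_left)
  qed
qed

section \<open>Monotonicity of the expected remaining time\<close>

lemma after_service_diff:
  "after_service q (\<lambda>j. f j - g j) (\<lambda>i j. v i j - w i j) i j =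
    after_service q f v i j - after_service q g w i j"
  by (simp add: after_service_def algebra_simps)

text \<open>
  Let \<open>f\<close> be the largest nondecreasing minorant of the diagonal of \<open>w\<close>, and \<open>g\<close> the corresponding cost
  of one cycle. Then \<open>g \<le> w\<close> because \<open>f \<le> w\<close> on the diagonal. Since \<open>g\<close> is nondecreasing on the
  diagonal, \<open>g j j \<le> g k k \<le> w k k\<close> for all \<open>k \<ge> j\<close>, that is, \<open>g j j \<le> f j\<close>. So replacing the terminal
  cost \<open>f\<close> by the smaller \<open>g j j\<close> shows that \<open>g\<close> is a supersolution of the system solved by \<open>w\<close>, hence
  \<open>w \<le> g\<close>, and \<open>w\<close> inherits the monotonicity of \<open>g\<close>.
\<close>
lemma wait_diagonal_mono:
  assumes u: "joining_up_to N u"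
    and w: "solves_wait u N w"
    and j: "1 \<le> j" "j < N"
  shows "w j j \<le> w (j + 1) (j + 1)"
proof -
  define f where "f j = Min ((\<lambda>k. w k k) ` {j..N})" for j
  define g where "g = cycle_wait u N f"
  have g: "solves_cycle u N f g"
    unfolding g_def by (rule solves_cycle_cycle_wait[OF u])
  have f_mono: "f j \<le> f (j + 1)" if "1 \<le> j" "j < N" for j
    unfolding f_def using that by (intro Min_antimono image_mono) auto
  have f_le: "f j \<le> w j j" if "1 \<le> j" "j \<le> N" for j
    unfolding f_def using that by (intro Min_le) auto
  have g_le_w: "g i j \<le> w i j" if "1 \<le> i" "i \<le> j" "j \<le> N" for i j
  proof -
    have "0 \<le> w i j - g i j"
    proof (rule cycle_lower_bound[OF u _ _ that, where f = "\<lambda>j. w j j - f j"])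
      fix i j :: nat assume "1 \<le> i" "i \<le> j" "j \<le> N"
      then show "lam * u (j + 1) * (w i (j + 1) - g i (j + 1)) +
          mu * after_service q (\<lambda>j. w j j - f j) (\<lambda>i j. w i j - g i j) i j
          \<le> (lam * u (j + 1) + mu) * (w i j - g i j)"
        using solves_cycleD[OF g, of i j] solves_cycleD[OF w, of i j]
        by (simp add: after_service_diff right_diff_distrib)
    qed (use f_le q_less_1 in auto)
    then show ?thesis by simp
  qed
  have g_diag: "g j j \<le> g k k" if "1 \<le> j" "j \<le> k" "k \<le> N" for j k
    using that(2,3)
  proof (induction rule: dec_induct)
    case (step n)
    then have "g n n + 1 / mu \<le> g (n + 1) (n + 1)"
      using that by (intro cycle_diagonal[OF u g f_mono]) auto
    moreover have "0 < 1 / mu" using mu_pos by simp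
    ultimately have "g n n \<le> g (n + 1) (n + 1)" by linarith
    with step show ?case by simp
  qed simp
  have g_le_f: "g j j \<le> f j" if "1 \<le> j" "j \<le> N" for j
  proof -
    have "g j j \<le> w k k" if "k \<in> {j..N}" for k
      using that \<open>1 \<le> j\<close> g_diag[of j k] g_le_w[of k k] by simp
    then show ?thesis unfolding f_def using that by simp
  qed
  have w_le_g: "w i j \<le> g i j" if "1 \<le> i" "i \<le> j" "j \<le> N" for i j
  proof -
    have "0 \<le> g i j - w i j"
    proof (rule comparison_principle[OF u _ that])
      fix i j :: nat assume ij: "1 \<le> i" "i \<le> j" "j \<le> N"
      have "after_service q (\<lambda>j. g j j) g i j \<le> after_service q f g i j"
        using g_le_f[of j] ij q_less_1 by (simp add: after_service_def)
      then have "mu * after_service q (\<lambda>j. g j j) g i j \<le> mu * after_service q f g i j"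
        using mu_pos by simp
      then show "lam * u (j + 1) * (g i (j + 1) - w i (j + 1)) +
          mu * after_service q (\<lambda>j. g j j - w j j) (\<lambda>i j. g i j - w i j) i j
          \<le> (lam * u (j + 1) + mu) * (g i j - w i j)"
        using solves_cycleD[OF g ij] solves_cycleD[OF w ij]
        by (simp add: after_service_diff right_diff_distrib)
    qed
    then show ?thesis by simp
  qed
  show ?thesis
    using w_le_g[of j j] g_diag[of j "j + 1"] g_le_w[of "j + 1" "j + 1"] j by simp
qed

lemma wait_diagonal_step:
  assumes u: "joining_up_to N u"
    and w: "solves_wait u N w"
    and j: "1 \<le> j" "j < N"
  shows "w j j + 1 / mu \<le> w (j + 1) (j + 1)"
  using j by (intro cycle_diagonal[OF u w wait_diagonal_mono[OF u w]]) auto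

text \<open>
  By \<open>wait_diagonal_step\<close> a longer queue strictly raises the cost of a failure; this enters at position
  1 with the positive weight \<open>1 - q\<close> and spreads to the other positions.
\<close>
lemma wait_strict_mono_behind:
  assumes u: "joining_up_to N u"
    and w: "solves_wait u N w"
    and ij: "1 \<le> i" "i \<le> j" "j < N"
  shows "w i j < w i (j + 1)"
  using ij
proof (induction i arbitrary: j rule: nat_induct_at_least[of 1])
  case (base j)
  let ?s = "after_service q (\<lambda>j. w j j) w 1"
  have "?s j < ?s (j + 1)" if "1 \<le> j" "j < N" for j
  proof -
    have "0 < 1 / mu" using mu_pos by simp
    with wait_diagonal_step[OF u w that] have "w j j < w (j + 1) (j + 1)" by linarith
    then show ?thesis using q_less_1 by (simp add: after_service_def)
  qed
  note s = this
  have "mu * (?s (j + 1) - ?s j) \<le> (lam * u (j + 1) + mu) * (w 1 (j + 1) - w 1 j)"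
    using s solves_cycleD[OF w, of 1] base by (intro row_increment(1)[OF u, of 1]) (auto intro: less_imp_le)
  moreover have "0 < mu * (?s (j + 1) - ?s j)" using s[OF base] mu_pos by simp
  ultimately show ?case
    using event_rate_pos[OF joining_nonneg[OF u, of "j + 1"]] by (smt (verit) zero_less_mult_iff)
next
  case (Suc i j)
  let ?s = "after_service q (\<lambda>j. w j j) w (Suc i)"
  have s: "?s j < ?s (j + 1)" if "Suc i \<le> j" "j < N" for j
  proof -
    have "q * w i (j - 1) + (1 - q) * w i j < q * w i j + (1 - q) * w i (j + 1)"
      using Suc.IH[of "j - 1"] Suc.IH[of j] that q_pos q_less_1
      by (intro add_strict_mono mult_strict_left_mono) auto
    then show ?thesis using Suc.hyps by (simp add: after_service_def)
  qed
  have "mu * (?s (j + 1) - ?s j) \<le> (lam * u (j + 1) + mu) * (w (Suc i) (j + 1) - w (Suc i) j)"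
    using s solves_cycleD[OF w, of "Suc i"] Suc.prems
    by (intro row_increment(1)[OF u, of "Suc i"]) (auto intro: less_imp_le)
  moreover have "0 < mu * (?s (j + 1) - ?s j)" using s[OF Suc.prems] mu_pos by simp
  ultimately show ?case
    using event_rate_pos[OF joining_nonneg[OF u, of "j + 1"]] by (smt (verit) zero_less_mult_iff)
qed

section \<open>Dependence on the joining probabilities\<close>

text \<open>
  Seen from the system for \<open>u\<close>, the solution for \<open>v\<close> has an additional source: the arrivals that join
  under \<open>v\<close> only, weighted with the harm that one more customer does.
\<close>
lemma wait_difference_equation:
  assumes wu: "solves_wait u N wu" and wv: "solves_wait v N wv"
    and ij: "1 \<le> i" "i \<le> j" "j \<le> N"
  shows "(lam * u (j + 1) + mu) * (wv i j - wu i j) =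
    lam * (v (j + 1) - u (j + 1)) * (wv i (j + 1) - wv i j) +
    lam * u (j + 1) * (wv i (j + 1) - wu i (j + 1)) +
    mu * after_service q (\<lambda>j. wv j j - wu j j) (\<lambda>i j. wv i j - wu i j) i j"
  using solves_cycleD[OF wu ij] solves_cycleD[OF wv ij]
  by (simp add: after_service_diff algebra_simps)

lemma wait_mono_joining:
  assumes u: "joining_up_to N u" and v: "joining_up_to N v" and le: "\<And>j. u j \<le> v j"
    and wu: "solves_wait u N wu" and wv: "solves_wait v N wv"
    and ij: "1 \<le> i" "i \<le> j" "j \<le> N"
  shows "wu i j \<le> wv i j"
    and "j < N \<Longrightarrow> u (j + 1) < v (j + 1) \<Longrightarrow> wu i j < wv i j"
proof -
  have extra: "0 \<le> lam * (v (j + 1) - u (j + 1)) * (wv i (j + 1) - wv i j)"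
    if "1 \<le> i" "i \<le> j" "j \<le> N" for i j
  proof (cases "j < N")
    case True
    then show ?thesis
      using that le[of "j + 1"] lam_pos wait_strict_mono_behind[OF v wv, of i j] by simp
  next
    case False
    then have "j = N" using that by simp
    then show ?thesis using joining_zero[OF u] joining_zero[OF v] by simp
  qed
  have nonneg: "0 \<le> wv i j - wu i j" if "1 \<le> i" "i \<le> j" "j \<le> N" for i j
  proof (rule comparison_principle[OF u _ that])
    fix i j :: nat assume ij: "1 \<le> i" "i \<le> j" "j \<le> N"
    show "lam * u (j + 1) * (wv i (j + 1) - wu i (j + 1)) +
      mu * after_service q (\<lambda>j. wv j j - wu j j) (\<lambda>i j. wv i j - wu i j) i j
      \<le> (lam * u (j + 1) + mu) * (wv i j - wu i j)"
      unfolding wait_difference_equation[OF wu wv ij] using extra[OF ij] by simp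
  qed
  from nonneg[OF ij] show "wu i j \<le> wv i j" by simp
  assume j: "j < N" and less: "u (j + 1) < v (j + 1)"
  have "0 < lam * (v (j + 1) - u (j + 1)) * (wv i (j + 1) - wv i j)"
    using less lam_pos wait_strict_mono_behind[OF v wv, of i j] ij j by simp
  moreover have "0 \<le> lam * u (j + 1) * (wv i (j + 1) - wu i (j + 1))"
    using nonneg[of i "j + 1"] ij j lam_pos joining_nonneg[OF u, of "j + 1"] by simp
  moreover have "0 \<le> mu * after_service q (\<lambda>j. wv j j - wu j j) (\<lambda>i j. wv i j - wu i j) i j"
  proof -
    have "0 \<le> after_service q (\<lambda>j. wv j j - wu j j) (\<lambda>i j. wv i j - wu i j) i j"
      unfolding after_service_def
      using nonneg[of j j] nonneg[of "i - 1" "j - 1"] nonneg[of "i - 1" j] ij q_pos q_less_1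
      by auto
    then show ?thesis using mu_pos by simp
  qed
  ultimately have "0 < (lam * u (j + 1) + mu) * (wv i j - wu i j)"
    unfolding wait_difference_equation[OF wu wv ij] by linarith
  then show "wu i j < wv i j"
    using event_rate_pos[OF joining_nonneg[OF u, of "j + 1"]] by (simp add: zero_less_mult_iff)
qed

text \<open>
  If the additional source is at most \<open>lam * c\<close>, then the difference is at most \<open>lam * c\<close> times the
  solution with unit source, which is \<open>wu\<close> itself.
\<close>
lemma wait_Lipschitz_joining:
  assumes u: "joining_up_to N u" and v: "joining_up_to N v" and le: "\<And>j. u j \<le> v j"
    and wu: "solves_wait u N wu" and wv: "solves_wait v N wv"
    and c: "\<And>i j. 1 \<le> i \<Longrightarrow> i \<le> j \<Longrightarrow> j \<le> N \<Longrightarrow>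
      (v (j + 1) - u (j + 1)) * (wv i (j + 1) - wv i j) \<le> c"
    and ij: "1 \<le> i" "i \<le> j" "j \<le> N"
  shows "wv i j - wu i j \<le> lam * c * wu i j"
proof -
  have "0 \<le> lam * c * wu i j - (wv i j - wu i j)"
  proof (rule comparison_principle[OF u _ ij])
    fix i j :: nat assume ij: "1 \<le> i" "i \<le> j" "j \<le> N"
    let ?E = "\<lambda>i j. wv i j - wu i j" and ?D = "\<lambda>i j. lam * c * wu i j - (wv i j - wu i j)"
    have "(lam * u (j + 1) + mu) * ?D i j =
        lam * c * ((lam * u (j + 1) + mu) * wu i j) - (lam * u (j + 1) + mu) * ?E i j"
      by (simp add: algebra_simps)
    also have "\<dots> = lam * (c - (v (j + 1) - u (j + 1)) * (wv i (j + 1) - wv i j)) +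
        (lam * u (j + 1) * ?D i (j + 1) + mu * after_service q (\<lambda>j. ?D j j) ?D i j)"
      unfolding wait_difference_equation[OF wu wv ij] solves_cycleD[OF wu ij]
      by (simp add: after_service_def algebra_simps)
    finally show "lam * u (j + 1) * ?D i (j + 1) + mu * after_service q (\<lambda>j. ?D j j) ?D i j
        \<le> (lam * u (j + 1) + mu) * ?D i j"
      using c[OF ij] lam_pos by simp
  qed
  then show ?thesis by simp
qed

end

section \<open>Thresholds between two consecutive integers\<close>

text \<open>
  The formula also holds at \<open>x = m + 1\<close>, so the whole closed interval can be treated uniformly.
\<close>
lemma join_prob_between:
  assumes "real m \<le> x" "x \<le> real m + 1"
  shows "join_prob x i = (if i \<le> m then 1 else if i = m + 1 then x - real m else 0)"
proof (cases "x = real m + 1")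
  case True
  then have "\<lfloor>x\<rfloor> = int (m + 1)" by simp
  then show ?thesis by (auto simp: join_prob_def frac_def True)
next
  case False
  then have "\<lfloor>x\<rfloor> = int m" using assms by (simp add: floor_eq_iff)
  then show ?thesis by (auto simp: join_prob_def frac_def)
qed

lemma joining_up_to_join_prob:
  assumes "0 \<le> x" "x \<le> real N"
  shows "joining_up_to N (join_prob x)"
proof -
  define m where "m = nat \<lfloor>x\<rfloor>"
  have x: "real m \<le> x" "x \<le> real m + 1"
    using assms(1) by (auto simp: m_def)
  moreover from x assms(2) have "m < N \<or> m = N \<and> x = real N" by linarith
  ultimately show ?thesis
    unfolding joining_up_to_def join_prob_between[OF x] by auto
qed

lemma is_arg_max_scaled:
  fixes p b :: real
  assumes "0 \<le> b" "b \<le> 1" "0 < p \<Longrightarrow> b = 1" "p < 0 \<Longrightarrow> b = 0"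
  shows "is_arg_max (\<lambda>a. a * p) (\<lambda>a. a \<in> {0..1}) b"
proof -
  have "a * p \<le> b * p" if "0 \<le> a" "a \<le> 1" for a
    using assms that by (cases p "0 :: real" rule: linorder_cases)
      (auto intro: mult_right_mono simp: mult_nonneg_nonpos)
  then show ?thesis using assms(1,2) by (auto simp: is_arg_max_def not_less)
qed

context feedback_queue
begin

abbreviation W :: "real \<Rightarrow> nat \<Rightarrow> nat \<Rightarrow> real" where
  "W \<equiv> wait_time lam mu q"

lemma solves_wait_wait_time: "solves_wait (join_prob x) N (W x)"
  unfolding solves_cycle_def after_service_def
  using wait_time_equation[OF lam_pos mu_pos q_pos q_less_1] by auto

lemma wait_time_diagonal_step:
  assumes "0 \<le> x" "1 \<le> j"
  shows "W x j j + 1 / mu \<le> W x (j + 1) (j + 1)"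
proof -
  \<comment> \<open>\<open>N\<close> must exceed \<open>j\<close> and be at least \<open>x\<close>, so that nobody joins at position \<open>N + 1\<close>.\<close>
  define N where "N = max (j + 1) (nat \<lceil>x\<rceil>)"
  have "x \<le> real N" "j < N" by (auto simp: N_def) linarith
  with assms show ?thesis
    by (intro wait_diagonal_step[OF joining_up_to_join_prob solves_wait_wait_time]) auto
qed

lemma wait_time_diagonal_mono:
  assumes "0 \<le> x" "1 \<le> j" "j \<le> k"
  shows "W x j j \<le> W x k k"
  using assms(3)
proof (induction rule: dec_induct)
  case (step n)
  have "0 < 1 / mu" using mu_pos by simp
  moreover have "W x n n + 1 / mu \<le> W x (n + 1) (n + 1)"
    using step assms by (intro wait_time_diagonal_step) auto
  ultimately have "W x n n \<le> W x (n + 1) (n + 1)" by linarith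
  with step show ?case by simp
qed simp

text \<open>
  With a threshold at most 1 nobody joins while the tagged customer is alone, so she is served again and
  again at rate \<open>mu\<close> until she succeeds.
\<close>
lemma wait_time_first:
  assumes "0 \<le> x" "x \<le> 1"
  shows "W x 1 1 = 1 / (q * mu)"
proof -
  have "join_prob x (1 + 1) = 0"
    using join_prob_between[of 0 x] assms by simp
  then have "mu * W x 1 1 = 1 + mu * ((1 - q) * W x 1 1)"
    using solves_cycleD[OF solves_wait_wait_time, of 1 1 1 x] by (simp add: after_service_def)
  then have "q * mu * W x 1 1 = 1" by (simp add: algebra_simps)
  then show ?thesis using q_pos mu_pos by (simp add: field_simps)
qed

context
  fixes m :: nat and x y :: real
  assumes x: "real m \<le> x" and xy: "x \<le> y" and y: "y \<le> real m + 1"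
begin

lemma joining_between:
  "joining_up_to (m + 1) (join_prob x)" "joining_up_to (m + 1) (join_prob y)"
  using x xy y by (auto intro: joining_up_to_join_prob)

lemma join_prob_le: "join_prob x j \<le> join_prob y j"
  using x xy y join_prob_between[of m x] join_prob_between[of m y] by auto

lemma wait_time_mono_threshold:
  assumes "1 \<le> i" "i \<le> j" "j \<le> m + 1"
  shows "W x i j \<le> W y i j"
  using assms
  by (intro wait_mono_joining(1)[OF joining_between join_prob_le
      solves_wait_wait_time solves_wait_wait_time])

text \<open>
  The two thresholds differ only in the probability of joining at position \<open>m + 1\<close>. This has no effect
  while \<open>m + 1\<close> customers are present, but with positive probability the first service leaves \<open>m\<close>, and
  from the state \<open>(m, m)\<close> the effect is immediate. For \<open>m = 0\<close> there is no such state.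
\<close>
lemma wait_time_strict_mono_threshold:
  assumes "x < y" "1 \<le> m"
  shows "W x (m + 1) (m + 1) < W y (m + 1) (m + 1)"
proof -
  have jp: "join_prob x (m + 1) < join_prob y (m + 1)"
    "join_prob x (m + 2) = 0" "join_prob y (m + 2) = 0"
    using x xy y assms join_prob_between[of m x] join_prob_between[of m y] by auto
  have "W x m m < W y m m"
    using assms jp
    by (intro wait_mono_joining(2)[OF joining_between join_prob_le
        solves_wait_wait_time solves_wait_wait_time]) auto
  moreover have "W x m (m + 1) \<le> W y m (m + 1)"
    using assms by (intro wait_time_mono_threshold) auto
  moreover have "W z (m + 1) (m + 1) = 1 / mu + (q * W z m m + (1 - q) * W z m (m + 1))"
    if "join_prob z (m + 2) = 0" for z
  proof -
    have "mu * W z (m + 1) (m + 1) = 1 + mu * (q * W z m m + (1 - q) * W z m (m + 1))"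
      using solves_cycleD[OF solves_wait_wait_time, of "m + 1" "m + 1" "m + 1" z] assms that
      by (simp add: after_service_def)
    then show ?thesis using mu_pos by (simp add: field_simps)
  qed
  ultimately show ?thesis
    using jp q_pos q_less_1 by (simp add: add_less_le_mono mult_left_mono)
qed

text \<open>
  The constant \<open>C\<close> is the value of \<open>wait_bound\<close> at \<open>i = j = m + 1\<close> for the threshold \<open>m + 1\<close>. It bounds both the
  harm done by one more customer and the solution with unit source.
\<close>
lemma wait_time_Lipschitz_threshold:
  defines "C \<equiv> (real m + 1 + (1 - q) / q * (real m + 2)) / mu"
  shows "W y (m + 1) (m + 1) - W x (m + 1) (m + 1) \<le> lam * C * C * (y - x)"
proof -
  have bound: "W z i (m + 1) \<le> C" if "1 \<le> i" "i \<le> m + 1" "real m \<le> z" "z \<le> real m + 1" for z i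
  proof -
    have "nat \<lfloor>z\<rfloor> \<le> m + 1" using that by linarith
    then have "real (max (m + 1) (nat \<lfloor>z\<rfloor> + 1)) \<le> real m + 2" by auto
    then have "wait_bound mu q z i (m + 1) \<le> C"
      unfolding C_def wait_bound_def using mu_pos q_pos q_less_1 that
      by (intro divide_right_mono add_mono mult_left_mono) auto
    then show ?thesis
      using wait_time_le[OF lam_pos mu_pos q_pos q_less_1, of i "m + 1" z] that by simp
  qed
  have C: "0 \<le> C" using bound[of "m + 1" x] wait_time_nonneg[of lam mu q x "m + 1" "m + 1"] x xy y by simp
  have "W y (m + 1) (m + 1) - W x (m + 1) (m + 1) \<le> lam * ((y - x) * C) * W x (m + 1) (m + 1)"
  proof (rule wait_Lipschitz_joining[OF joining_between join_prob_le
      solves_wait_wait_time solves_wait_wait_time])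
    fix i j :: nat assume ij: "1 \<le> i" "i \<le> j" "j \<le> m + 1"
    show "(join_prob y (j + 1) - join_prob x (j + 1)) * (W y i (j + 1) - W y i j) \<le> (y - x) * C"
    proof (cases "j = m")
      case True
      have "W y i (m + 1) - W y i m \<le> C"
        using bound[of i y] wait_time_nonneg[of lam mu q y i m] ij x xy y True by simp
      moreover have "join_prob y (j + 1) - join_prob x (j + 1) = y - x"
        using x xy y join_prob_between[of m x] join_prob_between[of m y] True by simp
      ultimately show ?thesis using xy True by (simp add: mult_left_mono)
    next
      case False
      then have "join_prob y (j + 1) = join_prob x (j + 1)"
        using x xy y join_prob_between[of m x] join_prob_between[of m y] by simp
      then show ?thesis using C xy by simp
    qed
  qed auto
  also have "\<dots> \<le> lam * ((y - x) * C) * C"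
    using bound[of "m + 1" x] C x xy y lam_pos by (intro mult_left_mono) auto
  finally show ?thesis by (simp add: mult_ac)
qed

end

lemma continuous_on_wait_time:
  "continuous_on {real m..real m + 1} (\<lambda>x. W x (m + 1) (m + 1))"
proof -
  define L where "L = lam * ((real m + 1 + (1 - q) / q * (real m + 2)) / mu) *
    ((real m + 1 + (1 - q) / q * (real m + 2)) / mu)"
  have "dist (W x (m + 1) (m + 1)) (W y (m + 1) (m + 1)) \<le> L * dist x y"
    if "real m \<le> x" "x \<le> y" "y \<le> real m + 1" for x y
    using wait_time_Lipschitz_threshold[OF that] wait_time_mono_threshold[OF that, of "m + 1" "m + 1"] that
    by (simp add: dist_real_def L_def)
  note le = this
  have "0 \<le> L" using lam_pos mu_pos q_pos q_less_1 by (simp add: L_def)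
  have "L-lipschitz_on {real m..real m + 1} (\<lambda>x. W x (m + 1) (m + 1))"
  proof (rule lipschitz_onI)
    fix x y assume "x \<in> {real m..real m + 1}" "y \<in> {real m..real m + 1}"
    then show "dist (W x (m + 1) (m + 1)) (W y (m + 1) (m + 1)) \<le> L * dist x y"
      using le[of x y] le[of y x] by (cases "x \<le> y") (auto simp: dist_commute)
  qed fact
  then show ?thesis by (rule lipschitz_on_continuous_on)
qed

section \<open>The critical rewards\<close>

abbreviation \<alpha> :: "nat \<Rightarrow> real" where "\<alpha> \<equiv> alpha lam mu q"
abbreviation \<beta> :: "nat \<Rightarrow> real" where "\<beta> \<equiv> beta lam mu q"

lemma beta_step:
  assumes "1 \<le> m"
  shows "\<alpha> m + 1 / mu \<le> \<beta> m"
  unfolding alpha_def beta_def using assms by (intro wait_time_diagonal_step) auto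

lemma alpha_less_beta:
  assumes "1 \<le> m"
  shows "\<alpha> m < \<beta> m"
proof -
  have "0 < 1 / mu" using mu_pos by simp
  with beta_step[OF assms] show ?thesis by linarith
qed

lemma beta_less_alpha:
  assumes "1 \<le> m"
  shows "\<beta> m < \<alpha> (m + 1)"
  using wait_time_strict_mono_threshold[of m "real m" "real m + 1"] assms
  by (simp add: alpha_def beta_def add.commute)

lemma alpha_step:
  assumes "1 \<le> m"
  shows "\<alpha> m + 1 / mu < \<alpha> (m + 1)"
  using beta_step[OF assms] beta_less_alpha[OF assms] by linarith

lemma alpha_strict_mono:
  assumes "1 \<le> m" "m < n"
  shows "\<alpha> m < \<alpha> n"
proof -
  have "\<alpha> k < \<alpha> (Suc k)" if "1 \<le> k" for k
    using alpha_less_beta[OF that] beta_less_alpha[OF that] by simp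
  then have "strict_mono (\<lambda>k. \<alpha> (k + 1))"
    by (intro strict_mono_Suc_iff[THEN iffD2]) auto
  then have "\<alpha> (m - 1 + 1) < \<alpha> (n - 1 + 1)"
    using assms by (intro strict_monoD[where f = "\<lambda>k. \<alpha> (k + 1)"]) auto
  then show ?thesis using assms by simp
qed

lemma alpha_lower_bound:
  assumes "1 \<le> m"
  shows "(real m - 1) / mu \<le> \<alpha> m"
  using assms
proof (induction rule: nat_induct_at_least)
  case base
  show ?case by (simp add: alpha_def wait_time_nonneg)
next
  case (Suc m)
  then show ?case using alpha_step[of m] by (simp add: diff_divide_distrib)
qed

lemma ex_alpha_bracket:
  assumes "\<alpha> 1 \<le> R"
  obtains m where "1 \<le> m" "\<alpha> m \<le> R" "R < \<alpha> (m + 1)"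
proof -
  \<comment> \<open>Some \<open>\<alpha>\<close> exceeds \<open>R\<close>; the required \<open>m\<close> precedes the first one that does.\<close>
  obtain n :: nat where n: "R * mu < real n" using reals_Archimedean2 by blast
  have "R < \<alpha> (n + 1)"
  proof -
    have "R < real n / mu" using n mu_pos by (simp add: pos_less_divide_eq)
    also have "\<dots> \<le> \<alpha> (n + 1)" using alpha_lower_bound[of "n + 1"] by simp
    finally show ?thesis .
  qed
  then have ex: "\<exists>k. R < \<alpha> (k + 1)" by blast
  define k where "k = (LEAST k. R < \<alpha> (k + 1))"
  have k: "R < \<alpha> (k + 1)" unfolding k_def using ex by (rule LeastI_ex)
  then have "k \<noteq> 0" using assms by (cases k) auto
  moreover have "\<not> R < \<alpha> (k - 1 + 1)"
    using not_less_Least[of "k - 1" "\<lambda>k. R < \<alpha> (k + 1)"] \<open>k \<noteq> 0\<close> by (simp add: k_def)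
  ultimately show ?thesis using k that[of k] by simp
qed

lemma ex1_chi:
  assumes m: "1 \<le> m" and R: "\<beta> m < R" "R < \<alpha> (m + 1)"
  shows "\<exists>!c. is_chi lam mu q R m c"
proof -
  let ?f = "\<lambda>x. W x (m + 1) (m + 1)"
  have ends: "?f (real m) = \<beta> m" "?f (real m + 1) = \<alpha> (m + 1)"
    by (simp_all add: alpha_def beta_def add.commute)
  obtain c where c: "real m \<le> c" "c \<le> real m + 1" "?f c = R"
    using IVT'[of ?f "real m" R "real m + 1"] continuous_on_wait_time ends R by auto
  then have "real m \<noteq> c" "c \<noteq> real m + 1" using ends R by auto
  with c have "is_chi lam mu q R m c" by (auto simp: is_chi_def)
  moreover have "c = d" if "is_chi lam mu q R m c" "is_chi lam mu q R m d" for c d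
    using wait_time_strict_mono_threshold[of m c d] wait_time_strict_mono_threshold[of m d c] that m
    by (cases c d rule: linorder_cases) (auto simp: is_chi_def)
  ultimately show ?thesis by blast
qed

lemma threshold_value_bracket:
  assumes m: "1 \<le> m" "\<alpha> m \<le> R" "R < \<alpha> (m + 1)" and R: "\<alpha> 1 < R"
  shows "threshold_value lam mu q R x \<longleftrightarrow>
    (if R \<le> \<beta> m then x = real m else is_chi lam mu q R m x)"
proof -
  have unique: "n = m" if n: "1 \<le> n" "\<alpha> n \<le> R" "R < \<alpha> (n + 1)" for n
  proof (rule ccontr)
    assume "n \<noteq> m"
    then consider "n + 1 = m" | "n + 1 < m" | "m + 1 = n" | "m + 1 < n" by linarith
    then show False
      using m n alpha_strict_mono[of "n + 1" m] alpha_strict_mono[of "m + 1" n] by cases auto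
  qed
  have "n = m" if "1 \<le> n" "\<alpha> n \<le> R" "R \<le> \<beta> n" for n
    using unique[of n] that beta_less_alpha[of n] by simp
  then have pure: "(\<exists>n\<ge>1. \<alpha> n \<le> R \<and> R \<le> \<beta> n \<and> x = real n) \<longleftrightarrow> R \<le> \<beta> m \<and> x = real m"
    using m by blast
  have "n = m" if "1 \<le> n" "\<beta> n < R" "R < \<alpha> (n + 1)" for n
    using unique[of n] that alpha_less_beta[of n] by simp
  then have mixed: "(\<exists>n\<ge>1. \<beta> n < R \<and> R < \<alpha> (n + 1) \<and> is_chi lam mu q R n x) \<longleftrightarrow>
      \<beta> m < R \<and> is_chi lam mu q R m x"
    using m by blast
  show ?thesis
    unfolding threshold_value_def pure mixed using R by simp
qed

section \<open>Best responses\<close>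

text \<open>
  Because the waiting time increases along the diagonal, a positive payoff at \<open>j\<close> forces \<open>j \<le> m\<close>,
  where everybody joins, and a negative payoff forces \<open>j > m\<close>; at \<open>j = m + 1\<close> it moreover excludes
  indifference, so that \<open>x = m\<close> and nobody joins there. The case \<open>m = 0\<close> covers thresholds in \<open>[0, 1]\<close>.
\<close>
lemma equilibrium_thresholdI:
  assumes x: "real m \<le> x" "x \<le> real m + 1"
    and join: "1 \<le> m \<Longrightarrow> W x m m \<le> R"
    and balk: "R \<le> W x (m + 1) (m + 1)"
    and mixed: "x = real m \<or> W x (m + 1) (m + 1) = R"
  shows "equilibrium_threshold lam mu q R x"
  unfolding equilibrium_threshold_def
proof (intro conjI ballI)
  have x0: "0 \<le> x" using x by linarith
  then show "0 \<le> x" .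
  fix j assume "j \<in> {1..nat \<lceil>x\<rceil> + 1}"
  then have j: "1 \<le> j" by simp
  show "is_arg_max (\<lambda>a. a * payoff lam mu q R x j j) (\<lambda>a. a \<in> {0..1}) (join_prob x j)"
  proof (rule is_arg_max_scaled[OF join_prob_bounds])
    assume "0 < payoff lam mu q R x j j"
    then have "W x j j < W x (m + 1) (m + 1)" using balk by (simp add: payoff_def)
    then have "\<not> m + 1 \<le> j" using wait_time_diagonal_mono[OF x0, of "m + 1" j] by auto
    then show "join_prob x j = 1" using join_prob_between[OF x] by simp
  next
    assume neg: "payoff lam mu q R x j j < 0"
    then have "\<not> j \<le> m"
      using wait_time_diagonal_mono[OF x0 j, of m] join j by (auto simp: payoff_def)
    moreover have "j \<noteq> m + 1 \<or> x = real m" using neg mixed by (auto simp: payoff_def)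
    ultimately show "join_prob x j = 0" using join_prob_between[OF x] by auto
  qed
qed

lemma threshold_value_equilibrium:
  assumes "threshold_value lam mu q R x"
  shows "equilibrium_threshold lam mu q R x"
proof -
  have first: "W z 1 1 = \<alpha> 1" if "0 \<le> z" "z \<le> 1" for z
    using wait_time_first[OF that] wait_time_first[of 1] by (simp add: alpha_def)
  from assms consider
      "R < \<alpha> 1" "x = 0"
    | "R = \<alpha> 1" "0 \<le> x" "x \<le> 1"
    | m where "1 \<le> m" "\<alpha> m \<le> R" "R \<le> \<beta> m" "x = real m"
    | m where "1 \<le> m" "is_chi lam mu q R m x"
    unfolding threshold_value_def by auto
  then show ?thesis
  proof cases
    case 1
    then show ?thesis using first[of 0] by (intro equilibrium_thresholdI[of 0]) auto
  next
    case 2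
    then show ?thesis using first[of x] by (intro equilibrium_thresholdI[of 0]) auto
  next
    case (3 m)
    then show ?thesis
      by (intro equilibrium_thresholdI[of m]) (auto simp: alpha_def beta_def)
  next
    case (4 m)
    then have c: "real m < x" "x < real m + 1" "W x (m + 1) (m + 1) = R"
      by (auto simp: is_chi_def)
    then show ?thesis
      using wait_time_diagonal_mono[of x m "m + 1"]
      by (intro equilibrium_thresholdI[of m]) auto
  qed
qed

end

theorem theorem3p1:
  fixes lam mu q R0 :: real
  assumes "0 < lam" and "0 < mu" and "0 < q" and "q < 1" and "0 < R0"
  shows
    "(\<forall>m\<ge>1. beta lam mu q m < R0 \<and> R0 < alpha lam mu q (m + 1) \<longrightarrow>
        (\<exists>!c. is_chi lam mu q R0 m c)) \<and>
     (\<exists>x. threshold_value lam mu q R0 x) \<and>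
     (R0 \<noteq> alpha lam mu q 1 \<longrightarrow> (\<exists>!x. threshold_value lam mu q R0 x)) \<and>
     (\<forall>x. threshold_value lam mu q R0 x \<longrightarrow> equilibrium_threshold lam mu q R0 x)"
proof -
  interpret feedback_queue lam mu q by unfold_locales fact+
  have unique: "\<exists>!x. threshold_value lam mu q R0 x" if "R0 \<noteq> \<alpha> 1"
  proof (cases "R0 < \<alpha> 1")
    case True
    have large: "R0 < \<alpha> m \<and> R0 < \<beta> m" if "1 \<le> m" for m
    proof -
      have "\<alpha> 1 \<le> \<alpha> m"
        using alpha_strict_mono[of 1 m] that by (cases "m = 1") auto
      then show ?thesis using True alpha_less_beta[OF that] by linarith
    qed
    have "\<not> (\<exists>m\<ge>1. \<alpha> m \<le> R0 \<and> R0 \<le> \<beta> m \<and> x = real m)"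
      "\<not> (\<exists>m\<ge>1. \<beta> m < R0 \<and> R0 < \<alpha> (m + 1) \<and> is_chi lam mu q R0 m x)" for x
      using large by (auto simp: not_le dest: order.asym)
    then have "threshold_value lam mu q R0 x \<longleftrightarrow> x = 0" for x
      unfolding threshold_value_def using True by auto
    then show ?thesis by simp
  next
    case False
    then have R: "\<alpha> 1 < R0" using that by simp
    obtain m where m: "1 \<le> m" "\<alpha> m \<le> R0" "R0 < \<alpha> (m + 1)"
      using ex_alpha_bracket[OF less_imp_le[OF R]] .
    show ?thesis
    proof (cases "R0 \<le> \<beta> m")
      case True
      then show ?thesis by (simp add: threshold_value_bracket[OF m R])
    next
      case False
      then show ?thesis
        using ex1_chi[of m R0] m by (simp add: threshold_value_bracket[OF m R])
    qed
  qed
  moreover have "threshold_value lam mu q R0 0" if "R0 = \<alpha> 1"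
    using that by (simp add: threshold_value_def)
  ultimately show ?thesis
    using ex1_chi threshold_value_equilibrium by blast
qed

end
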